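(* Let $O,A,B$ be three pairwise distinct points of the Euclidean plane $\mathbb{R}^2$, let $\vec\alpha=\frac{1}{OA}\overrightarrow{AO}$, $\vec\beta=\frac{1}{OB}\overrightarrow{OB}$, let $\Omega\in]-\pi,\pi]$ be the principal determination of the oriented angle from $\vec\alpha$ to $\vec\beta$, and assume $\Omega\in]0,\pi[$. Let $\mathcal{E}$, the curve $\mathcal{J}(O,A,B)$, its radius $R_a(O,A,B)$ and, for $R>0$, the Dubins curve $\mathcal{G}(R)$ be as defined in the context, and set $$\mathcal{F}=\{R\in]0,+\infty[\;:\;\mathcal{G}(R)\in\mathcal{E}\}.$$ Then $\mathcal{F}=]0,R_a(O,A,B)]$, and the Dubins curve $\mathcal{G}(R_a(O,A,B))$ is equal to $\mathcal{J}(O,A,B)$.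
   Context: $\|\cdot\|$ is the Euclidean norm of $\mathbb{R}^2$. Let $\vec k$ be the unit vector obtained by rotating $\vec\alpha$ by $+\pi/2$. Definition of $\mathcal{E}$: the set of all curves $X:[0,L]\to\mathbb{R}^2$, with $L=L(X)>0$ depending on $X$, such that $X\in W^{2,\infty}(0,L;\mathbb{R}^2)$ (hence $X$ is $C^1$ on $[0,L]$), $\|X'(s)\|=1$ for all $s\in[0,L]$, $X(0)=A$, $X(L)=B$, $X'(0)=\vec\alpha$, $X'(L)=\vec\beta$, and such that the angle $\phi$ is nondecreasing on $[0,L]$. Here $\phi:[0,L]\to\mathbb{R}$ is the continuous determination of the oriented angle from $\vec\alpha$ to $X'(s)$, i.e. $X'(s)=\cos\phi(s)\,\vec\alpha+\sin\phi(s)\,\vec k$; equalities of angles are understood strictly and not modulo $2\pi$, so that $\phi(0)=0$, $\phi(L)=\Omega$ and hence $\phi(s)\in[0,\Omega]$ for all $s$. Definition of $\mathcal{J}(O,A,B)$ and $R_a(O,A,B)$: if $OA=OB$, $\mathcal{J}(O,A,B)$ is the unique curve of $\mathcal{E}$ consisting of one circular arc of some radius $R_a>0$ and of length in $]0,R_a\pi[$; if $OA\neq OB$, it is the unique curve of $\mathcal{E}$ consisting of one circular arc of some radius $R_a>0$ and of length in $]0,R_a\pi[$, together with one line segment of nonzero length (in either order). Such a curve exists and is unique, and its radius $R_a$ is denoted $R_a(O,A,B)$. Dubins curve $\mathcal{G}(R)$: for $R>0$, $\mathcal{G}(R)$ denotes the Dubins geodesic of parameter $R$, i.e. the curve of minimal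 length among all curves $X:[0,L]\to\mathbb{R}^2$ (with $L$ free) parametrized by arc length, with $X\in W^{2,\infty}(0,L;\mathbb{R}^2)$, $X(0)=A$, $X(L)=B$, $X'(0)=\vec\alpha$, $X'(L)=\vec\beta$, whose radius of curvature is everywhere at least $R$ (i.e. $\|X''(s)\|\le 1/R$ for a.e. $s$); no sign condition on the curvature is imposed here. It is regarded as determined by $R$ (for the given $A,B,\vec\alpha,\vec\beta$). By Dubins' theorem it is a union of three circular arcs of radius $R$, or of two circular arcs of radius $R$ joined by a line segment, or a sub-path of one of these. *)

theory Defs
  imports "HOL-Analysis.Analysis"
begin

text \<open>The Euclidean plane is \<^typ>\<open>complex\<close>, with its Euclidean norm; multiplication by \<^term>\<open>\<i>\<close>
  is the rotation by \<open>+\<pi>/2\<close>. The letter \<open>O\<close> is reserved syntax in HOL, so the point \<open>O\<close> is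
  written \<open>P\<close>.\<close>

subsection \<open>The Sobolev space \<open>W\<^sup>2\<^sup>,\<^sup>\<infinity>(0, L)\<close>\<close>

text \<open>One-dimensional Sobolev spaces, with test functions of class \<open>C\<^sup>1\<close> with compact support in
  the open interval (as in Brezis' textbook). Functions are not quotiented by almost everywhere
  equality.\<close>

definition test_functions :: "real \<Rightarrow> (real \<Rightarrow> real) set" where
  "test_functions L = {f. f C1_differentiable_on UNIV \<and>
     compact (closure {t. f t \<noteq> 0}) \<and> closure {t. f t \<noteq> 0} \<subseteq> {0<..<L}}"

definition L_inf :: "real \<Rightarrow> (real \<Rightarrow> complex) set" where
  "L_inf L = {u. set_borel_measurable lebesgue {0<..<L} u \<and>
     (\<exists>C. AE t in lebesgue. t \<in> {0<..<L} \<longrightarrow> norm (u t) \<le> C)}"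

definition weak_derivative :: "real \<Rightarrow> (real \<Rightarrow> complex) \<Rightarrow> (real \<Rightarrow> complex) \<Rightarrow> bool" where
  "weak_derivative L u v \<longleftrightarrow> (\<forall>f \<in> test_functions L.
     set_lebesgue_integral lebesgue {0<..<L} (\<lambda>t. deriv f t *\<^sub>R u t) =
     - set_lebesgue_integral lebesgue {0<..<L} (\<lambda>t. f t *\<^sub>R v t))"

definition W1_inf :: "real \<Rightarrow> (real \<Rightarrow> complex) set" where
  "W1_inf L = {u \<in> L_inf L. \<exists>v \<in> L_inf L. weak_derivative L u v}"

definition W2_inf :: "real \<Rightarrow> (real \<Rightarrow> complex) set" where
  "W2_inf L = {u \<in> L_inf L. \<exists>v \<in> W1_inf L. weak_derivative L u v}"

subsection \<open>Curves parametrized by arc length\<close>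

text \<open>A curve \<open>X : [0, L] \<rightarrow> \<real>\<^sup>2\<close> is the pair \<open>(L, X)\<close>, where the total function \<open>X\<close> is
  \<^const>\<open>undefined\<close> outside \<open>[0, L]\<close>, so that equality of pairs is equality of curves.\<close>

type_synonym curve = "real \<times> (real \<Rightarrow> complex)"

definition tangent :: "real \<Rightarrow> (real \<Rightarrow> complex) \<Rightarrow> real \<Rightarrow> complex" where
  "tangent L X s = vector_derivative X (at s within {0..L})"

definition alpha :: "complex \<Rightarrow> complex \<Rightarrow> complex" where
  "alpha P A = (1 / dist P A) *\<^sub>R (P - A)"

definition beta :: "complex \<Rightarrow> complex \<Rightarrow> complex" where
  "beta P B = (1 / dist P B) *\<^sub>R (B - P)"

definition Omega :: "complex \<Rightarrow> complex \<Rightarrow> complex \<Rightarrow> real" where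
  "Omega P A B = Arg (beta P B / alpha P A)"

text \<open>The two conditions on differentiability select the \<open>C\<^sup>1\<close> representative of the element
  of \<open>W\<^sup>2\<^sup>,\<^sup>\<infinity>\<close>.\<close>

definition joining_curves :: "complex \<Rightarrow> complex \<Rightarrow> complex \<Rightarrow> curve set" where
  "joining_curves P A B = {(L, X). 0 < L \<and> X \<in> extensional {0..L} \<and> X \<in> W2_inf L \<and>
     (\<forall>s \<in> {0..L}. X differentiable (at s within {0..L})) \<and> continuous_on {0..L} (tangent L X) \<and>
     (\<forall>s \<in> {0..L}. norm (tangent L X s) = 1) \<and>
     X 0 = A \<and> X L = B \<and> tangent L X 0 = alpha P A \<and> tangent L X L = beta P B}"

text \<open>The set \<open>\<E>\<close>. The condition \<open>\<phi> L = \<Omega>\<close> is an equality of real numbers, not modulo \<open>2\<pi>\<close>.\<close>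

definition curves_E :: "complex \<Rightarrow> complex \<Rightarrow> complex \<Rightarrow> curve set" where
  "curves_E P A B = {(L, X). (L, X) \<in> joining_curves P A B \<and>
     (\<exists>\<phi>. continuous_on {0..L} \<phi> \<and> \<phi> 0 = 0 \<and> \<phi> L = Omega P A B \<and> mono_on {0..L} \<phi> \<and>
       (\<forall>s \<in> {0..L}. tangent L X s =
          cos (\<phi> s) *\<^sub>R alpha P A + sin (\<phi> s) *\<^sub>R (\<i> * alpha P A)))}"

subsection \<open>The curve \<open>\<J>(O, A, B)\<close> and the radius \<open>R\<^sub>a(O, A, B)\<close>\<close>

text \<open>Restriction of \<open>X\<close> to \<open>[a, b]\<close> being a circular arc of radius \<open>r\<close> (travelled in either
  direction), resp. a line segment, at unit speed; its length is \<open>b - a\<close>.\<close>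

definition circular_arc :: "real \<Rightarrow> (real \<Rightarrow> complex) \<Rightarrow> real \<Rightarrow> real \<Rightarrow> bool" where
  "circular_arc r X a b \<longleftrightarrow> (\<exists>c \<theta> \<epsilon>. \<epsilon> \<in> {-1, 1} \<and>
     (\<forall>s \<in> {a..b}. X s = c + r *\<^sub>R cis (\<theta> + \<epsilon> * (s - a) / r)))"

definition line_segment :: "(real \<Rightarrow> complex) \<Rightarrow> real \<Rightarrow> real \<Rightarrow> bool" where
  "line_segment X a b \<longleftrightarrow> (\<exists>p u. norm u = 1 \<and> (\<forall>s \<in> {a..b}. X s = p + (s - a) *\<^sub>R u))"

fun is_J_curve :: "complex \<Rightarrow> complex \<Rightarrow> complex \<Rightarrow> real \<Rightarrow> curve \<Rightarrow> bool" where
  "is_J_curve P A B r (L, X) \<longleftrightarrow> (L, X) \<in> curves_E P A B \<and> 0 < r \<and>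
     (if dist P A = dist P B
      then circular_arc r X 0 L \<and> L < r * pi
      else (\<exists>m. 0 < m \<and> m < L \<and>
        (circular_arc r X 0 m \<and> m < r * pi \<and> line_segment X m L \<or>
         line_segment X 0 m \<and> circular_arc r X m L \<and> L - m < r * pi)))"

definition J_curve :: "complex \<Rightarrow> complex \<Rightarrow> complex \<Rightarrow> curve" where
  "J_curve P A B = (THE X. \<exists>r. is_J_curve P A B r X)"

definition R_a :: "complex \<Rightarrow> complex \<Rightarrow> complex \<Rightarrow> real" where
  "R_a P A B = (THE r. is_J_curve P A B r (J_curve P A B))"

subsection \<open>Dubins geodesics\<close>

text \<open>\<open>W\<close> is the weak derivative \<open>X''\<close> of \<open>X'\<close>, unique up to almost everywhere equality.\<close>

definition dubins_admissible :: "complex \<Rightarrow> complex \<Rightarrow> complex \<Rightarrow> real \<Rightarrow> curve set" where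
  "dubins_admissible P A B R = {(L, X). (L, X) \<in> joining_curves P A B \<and>
     (\<exists>W \<in> L_inf L. weak_derivative L (tangent L X) W \<and>
       (AE s in lebesgue. s \<in> {0<..<L} \<longrightarrow> norm (W s) \<le> 1 / R))}"

text \<open>A length minimizer need not be unique for every \<open>R\<close>, so \<open>\<G>(R)\<close> is a predicate.\<close>

definition is_dubins_geodesic :: "complex \<Rightarrow> complex \<Rightarrow> complex \<Rightarrow> real \<Rightarrow> curve \<Rightarrow> bool" where
  "is_dubins_geodesic P A B R G \<longleftrightarrow> G \<in> dubins_admissible P A B R \<and>
     (\<forall>Y \<in> dubins_admissible P A B R. fst G \<le> fst Y)"

definition set_F :: "complex \<Rightarrow> complex \<Rightarrow> complex \<Rightarrow> real set" where
  "set_F P A B = {R. 0 < R \<and> (\<exists>G. is_dubins_geodesic P A B R G \<and> G \<in> curves_E P A B)}"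

end

theory Submission
  imports Defs
begin

text \<open>Write \<open>a\<close> for the initial tangent, \<open>\<Omega>\<close> for the total turn, \<open>dA\<close>, \<open>dB\<close> for the distances of
  \<open>A\<close>, \<open>B\<close> from the corner \<open>P\<close>; then \<open>B - A = a (dA + dB cis \<Omega>)\<close>, and \<open>R\<^sub>a = min dA dB / tan (\<Omega>/2)\<close>.

  An admissible curve of parameter \<open>R\<close> has a \<open>1/R\<close>-Lipschitz tangent
  (\<open>weak_derivative_lipschitz\<close>), hence a \<open>1/R\<close>-Lipschitz tangent angle \<open>\<phi>\<close>, with
  \<open>\<integral> cis \<phi> = dA + dB cis \<Omega>\<close>. If \<open>R tan (\<Omega>/2) \<le> min dA dB\<close>, then there are \<open>g \<ge> 0\<close> and
  \<open>\<psi> \<in> [0, \<Omega>]\<close> such that a left arc of radius \<open>R\<close> and angle \<open>\<psi>\<close>, a segment of length \<open>g\<close> and a left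
  arc of angle \<open>\<Omega> - \<psi>\<close> lead from \<open>A\<close> to \<open>B\<close> (\<open>cone_polar_form\<close>). This curve is the unique length
  minimizer: projecting any competitor to the direction \<open>\<psi>\<close> of the segment turns its length into a
  constant plus \<open>\<integral> (1 - cos (\<phi> - \<psi>))\<close>, and \<open>angle_cost\<close> bounds this integral below by its value for
  the arc-line-arc curve, with equality only for that curve. The bound is pointwise, because a
  Lipschitz angle cannot come closer to \<open>\<psi>\<close> than turning at full speed allows, unless \<open>\<phi>\<close> passes
  through the direction opposite to \<open>\<psi>\<close>; in that case the cost is strictly larger. So for these \<open>R\<close> the
  geodesic is unique and lies in \<open>\<E>\<close>.

  Conversely, for an admissible curve in \<open>\<E>\<close> the integrals \<open>\<integral> sin \<phi> = dB sin \<Omega>\<close> and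
  \<open>\<integral> sin (\<Omega> - \<phi>) = dA sin \<Omega>\<close> are at least \<open>R (1 - cos \<Omega>)\<close>, i.e. \<open>R tan (\<Omega>/2) \<le> min dA dB\<close>
  (\<open>curves_E_radius_bound\<close>). Finally the curve \<open>\<J>\<close> is an arc-line-arc curve with \<open>\<psi> \<in> {0, \<Omega>}\<close>, which
  forces \<open>r tan (\<Omega>/2) = min dA dB\<close> for its radius \<open>r\<close>, and so it is the geodesic of parameter
  \<open>r = R\<^sub>a\<close>.\<close>

section \<open>Weak derivatives\<close>

lemma emeasure_lborel_Ioo_finite: "emeasure lborel {0<..<L::real} < top"
  by (cases "0 \<le> L") auto

lemma L_inf_scaleR_integrable:
  fixes g :: "real \<Rightarrow> real"
  assumes u: "u \<in> L_inf L" and g: "continuous_on {0..L} g"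
  shows "set_integrable lebesgue {0<..<L} (\<lambda>t. g t *\<^sub>R u t)"
proof -
  obtain C where C: "AE t in lebesgue. t \<in> {0<..<L} \<longrightarrow> norm (u t) \<le> C"
    using u by (auto simp: L_inf_def)
  have "bounded (g ` {0..L})"
    using g by (intro compact_imp_bounded compact_continuous_image) auto
  then obtain M where M: "\<And>t. t \<in> {0..L} \<Longrightarrow> \<bar>g t\<bar> \<le> M"
    unfolding bounded_iff by force
  have um: "(\<lambda>t. indicator {0<..<L} t *\<^sub>R u t) \<in> borel_measurable lebesgue"
    using u by (auto simp: L_inf_def set_borel_measurable_def)
  have "continuous_on {0<..<L} g"
    using g by (rule continuous_on_subset) auto
  then have "(\<lambda>t. indicator {0<..<L} t *\<^sub>R g t) \<in> borel_measurable borel"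
    by (intro borel_measurable_continuous_on_indicator) auto
  then have gm: "(\<lambda>t. indicator {0<..<L} t *\<^sub>R g t) \<in> borel_measurable lebesgue"
    by (intro measurable_completion) auto
  have "(\<lambda>t. (indicator {0<..<L} t *\<^sub>R g t) *\<^sub>R (indicator {0<..<L} t *\<^sub>R u t))
      \<in> borel_measurable lebesgue"
    by (intro borel_measurable_scaleR gm um)
  also have "(\<lambda>t. (indicator {0<..<L} t *\<^sub>R g t) *\<^sub>R (indicator {0<..<L} t *\<^sub>R u t))
      = (\<lambda>t. indicator {0<..<L} t *\<^sub>R (g t *\<^sub>R u t))"
    by (auto simp: indicator_def)
  finally have meas: "(\<lambda>t. indicator {0<..<L} t *\<^sub>R (g t *\<^sub>R u t)) \<in> borel_measurable lebesgue" .
  have int: "integrable lebesgue (\<lambda>t. indicator {0<..<L} t * (M * C) :: real)"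
    by (intro integrable_mult_left integrable_real_indicator) (auto simp: emeasure_lborel_Ioo_finite)
  have "AE t in lebesgue. norm (indicator {0<..<L} t *\<^sub>R (g t *\<^sub>R u t))
      \<le> norm (indicator {0<..<L} t * (M * C))"
    using C
  proof eventually_elim
    case (elim t)
    show ?case
    proof (cases "t \<in> {0<..<L}")
      case True
      then have "\<bar>g t\<bar> * norm (u t) \<le> M * C"
        using elim M[of t] by (intro mult_mono) auto
      then show ?thesis using True by simp
    qed auto
  qed
  then show ?thesis
    unfolding set_integrable_def by (rule Bochner_Integration.integrable_bound[OF int meas])
qed

lemma continuous_in_L_inf:
  assumes "continuous_on {0..L} u"
  shows "u \<in> L_inf L"
proof -
  have "bounded (u ` {0..L})"
    using assms by (intro compact_imp_bounded compact_continuous_image) auto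
  then obtain C where "\<And>t. t \<in> {0..L} \<Longrightarrow> norm (u t) \<le> C"
    unfolding bounded_iff by force
  then have "AE t in lebesgue. t \<in> {0<..<L} \<longrightarrow> norm (u t) \<le> C"
    by auto
  moreover have "continuous_on {0<..<L} u"
    using assms by (rule continuous_on_subset) auto
  then have "(\<lambda>t. indicator {0<..<L} t *\<^sub>R u t) \<in> borel_measurable borel"
    by (intro borel_measurable_continuous_on_indicator) auto
  then have "(\<lambda>t. indicator {0<..<L} t *\<^sub>R u t) \<in> borel_measurable lebesgue"
    by (intro measurable_completion) auto
  ultimately show ?thesis
    by (auto simp: L_inf_def set_borel_measurable_def)
qed

lemma test_functions_derivative:
  assumes "f \<in> test_functions L"
  obtains "\<And>t. (f has_real_derivative deriv f t) (at t)" "continuous_on UNIV (deriv f)"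
    "\<And>t. t \<notin> {0<..<L} \<Longrightarrow> f t = 0"
proof
  obtain D where D: "\<And>t. (f has_vector_derivative D t) (at t)" "continuous_on UNIV D"
    using assms by (auto simp: test_functions_def C1_differentiable_on_def)
  have *: "(f has_real_derivative D t) (at t)" for t
    using D(1) by (simp add: has_real_derivative_iff_has_vector_derivative)
  have "deriv f = D"
    using * by (intro ext DERIV_imp_deriv)
  then show "\<And>t. (f has_real_derivative deriv f t) (at t)" "continuous_on UNIV (deriv f)"
    using * D(2) by auto
  show "f t = 0" if "t \<notin> {0<..<L}" for t
  proof (rule ccontr)
    assume "f t \<noteq> 0"
    then have "t \<in> closure {t. f t \<noteq> 0}" by (intro subsetD[OF closure_subset]) simp
    then show False using assms that by (auto simp: test_functions_def)
  qed
qed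

text \<open>Integration by parts: a continuous function with an essentially bounded derivative outside a
  finite set has that derivative as weak derivative.\<close>

lemma weak_derivative_of_derivative:
  assumes u: "continuous_on {0..L} u" and v: "v \<in> L_inf L" and S: "finite S"
    and deriv: "\<And>t. t \<in> {0<..<L} - S \<Longrightarrow> (u has_vector_derivative v t) (at t)"
    and L: "0 < L"
  shows "weak_derivative L u v"
  unfolding weak_derivative_def
proof
  fix f assume f: "f \<in> test_functions L"
  obtain Df: "\<And>t. (f has_real_derivative deriv f t) (at t)" and cf': "continuous_on UNIV (deriv f)"
    and f0: "\<And>t. t \<notin> {0<..<L} \<Longrightarrow> f t = 0"
    using test_functions_derivative[OF f] by blast
  have cf: "continuous_on UNIV f"
    using Df by (meson DERIV_isCont continuous_at_imp_continuous_on)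
  have i1: "set_integrable lebesgue {0<..<L} (\<lambda>t. deriv f t *\<^sub>R u t)"
    by (intro L_inf_scaleR_integrable continuous_in_L_inf u continuous_on_subset[OF cf']) auto
  have i2: "set_integrable lebesgue {0<..<L} (\<lambda>t. f t *\<^sub>R v t)"
    by (intro L_inf_scaleR_integrable v continuous_on_subset[OF cf]) auto
  have "((\<lambda>t. f t *\<^sub>R v t + deriv f t *\<^sub>R u t) has_integral (f L *\<^sub>R u L - f 0 *\<^sub>R u 0)) {0..L}"
  proof (rule fundamental_theorem_of_calculus_interior_strong[OF S])
    show "((\<lambda>t. f t *\<^sub>R u t) has_vector_derivative f t *\<^sub>R v t + deriv f t *\<^sub>R u t) (at t)"
      if "t \<in> {0<..<L} - S" for t
      by (rule has_vector_derivative_scaleR[OF Df deriv[OF that]])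
    show "continuous_on {0..L} (\<lambda>t. f t *\<^sub>R u t)"
      by (intro continuous_intros u continuous_on_subset[OF cf]) auto
  qed (use L in auto)
  then have "((\<lambda>t. f t *\<^sub>R v t + deriv f t *\<^sub>R u t) has_integral 0) {0<..<L}"
    using f0[of 0] f0[of L] by (simp add: has_integral_Icc_iff_Ioo)
  then have "integral {0<..<L} (\<lambda>t. f t *\<^sub>R v t) + integral {0<..<L} (\<lambda>t. deriv f t *\<^sub>R u t) = 0"
    by (subst integral_add[symmetric])
       (auto simp: integral_unique intro: set_lebesgue_integral_eq_integral(1) i1 i2)
  then show "set_lebesgue_integral lebesgue {0<..<L} (\<lambda>t. deriv f t *\<^sub>R u t) =
     - set_lebesgue_integral lebesgue {0<..<L} (\<lambda>t. f t *\<^sub>R v t)"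
    by (simp add: set_lebesgue_integral_eq_integral(2)[OF i1]
        set_lebesgue_integral_eq_integral(2)[OF i2] eq_neg_iff_add_eq_0 add.commute)
qed

text \<open>The hat function with support \<open>[0, 2]\<close> and integral \<open>1\<close>, and its primitive, a step of class
  \<open>C\<^sup>1\<close> from \<open>0\<close> to \<open>1\<close>. Differences of translated steps serve as test functions approximating
  indicators of intervals.\<close>

definition hat :: "real \<Rightarrow> real" where
  "hat x = max 0 x - 2 * max 0 (x - 1) + max 0 (x - 2)"

definition smooth_step :: "real \<Rightarrow> real" where
  "smooth_step x = ((max 0 x)\<^sup>2 - 2 * (max 0 (x - 1))\<^sup>2 + (max 0 (x - 2))\<^sup>2) / 2"

lemma DERIV_max_0_square: "((\<lambda>x::real. (max 0 x)\<^sup>2) has_real_derivative 2 * max 0 x) (at x)"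
proof -
  consider "x < 0" | "x = 0" | "x > 0" by linarith
  then show ?thesis
  proof cases
    case 1
    have "((\<lambda>x::real. 0) has_real_derivative 0) (at x)" by simp
    then have "((\<lambda>x::real. (max 0 x)\<^sup>2) has_real_derivative 0) (at x)"
      by (rule has_field_derivative_transform_within_open[of _ _ _ "{..<0}"]) (use 1 in auto)
    then show ?thesis using 1 by simp
  next
    case 2
    have "((\<lambda>h::real. max 0 h) \<longlongrightarrow> max 0 0) (at 0)"
      by (intro tendsto_intros)
    moreover have "\<forall>\<^sub>F h::real in at 0. max 0 h = ((max 0 (0 + h))\<^sup>2 - (max 0 0)\<^sup>2) / h"
      by (auto simp: eventually_at_filter max_def power2_eq_square)
    ultimately have "((\<lambda>h::real. ((max 0 (0 + h))\<^sup>2 - (max 0 0)\<^sup>2) / h) \<longlongrightarrow> max 0 0) (at 0)"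
      by (rule Lim_transform_eventually)
    then show ?thesis using 2 by (simp add: DERIV_def)
  next
    case 3
    have "((\<lambda>x::real. x\<^sup>2) has_real_derivative 2 * x) (at x)"
      by (auto intro!: derivative_eq_intros)
    then have "((\<lambda>x::real. (max 0 x)\<^sup>2) has_real_derivative 2 * x) (at x)"
      by (rule has_field_derivative_transform_within_open[of _ _ _ "{0<..}"]) (use 3 in auto)
    then show ?thesis using 3 by simp
  qed
qed

lemma DERIV_smooth_step: "(smooth_step has_real_derivative hat x) (at x)"
proof -
  have shift: "((\<lambda>x::real. (max 0 (x - c))\<^sup>2) has_real_derivative 2 * max 0 (x - c)) (at x)" for c
  proof -
    have "((\<lambda>x. x - c) has_real_derivative 1) (at x)"
      by (auto intro!: derivative_eq_intros)
    from DERIV_chain2[OF DERIV_max_0_square this] show ?thesis by simp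
  qed
  show ?thesis
    unfolding smooth_step_def[abs_def]
    by (rule derivative_eq_intros DERIV_max_0_square shift refl | simp)+ (simp add: hat_def)
qed

lemma hat_nonneg: "0 \<le> hat x"
  by (auto simp: hat_def max_def)

lemma hat_eq_0: "x \<notin> {0..2} \<Longrightarrow> hat x = 0"
  by (auto simp: hat_def max_def)

lemma continuous_on_hat: "continuous_on S hat"
  unfolding hat_def[abs_def] by (intro continuous_intros)

lemma smooth_step_0: "x \<le> 0 \<Longrightarrow> smooth_step x = 0"
  by (simp add: smooth_step_def)

lemma smooth_step_1: "2 \<le> x \<Longrightarrow> smooth_step x = 1"
  by (simp add: smooth_step_def power2_eq_square algebra_simps)

lemma smooth_step_mono: "x \<le> y \<Longrightarrow> smooth_step x \<le> smooth_step y"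
  by (rule DERIV_nonneg_imp_nondecreasing[of x y]) (use DERIV_smooth_step hat_nonneg in blast)+

lemma smooth_step_bounds: "0 \<le> smooth_step x" "smooth_step x \<le> 1"
  using smooth_step_mono[of "min x 0" x] smooth_step_0[of "min x 0"]
    smooth_step_mono[of x "max x 2"] smooth_step_1[of "max x 2"] by auto

lemma DERIV_smooth_step_scaled:
  assumes "0 < e"
  shows "((\<lambda>t. smooth_step ((t - c) / e)) has_real_derivative hat ((t - c) / e) / e) (at t)"
proof -
  have "((\<lambda>t. (t - c) / e) has_real_derivative 1 / e) (at t)"
    using assms by (auto intro!: derivative_eq_intros)
  from DERIV_chain2[OF DERIV_smooth_step this] show ?thesis by simp
qed

lemma continuous_on_hat_scaled: "continuous_on S (\<lambda>t. hat ((t - c) / e) / e)"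
proof (cases "e = 0")
  case False
  then show ?thesis
    by (intro continuous_intros continuous_on_compose2[OF continuous_on_hat[of UNIV]]) auto
qed auto

text \<open>Averaging against a narrow bump approximates the value at the bump.\<close>

lemma hat_average:
  fixes T :: "real \<Rightarrow> complex"
  assumes T: "continuous_on {0..L} T" and e: "0 < e" and c: "0 \<le> c" "c + 2 * e \<le> L"
    and osc: "\<And>t. t \<in> {c..c + 2 * e} \<Longrightarrow> norm (T t - T c) \<le> \<eta>"
  shows "norm (integral {0..L} (\<lambda>t. (hat ((t - c) / e) / e) *\<^sub>R T t) - T c) \<le> \<eta>"
proof -
  let ?w = "\<lambda>t. hat ((t - c) / e) / e"
  have cw: "continuous_on {0..L} ?w" by (rule continuous_on_hat_scaled)
  have "(?w has_integral (smooth_step ((L - c) / e) - smooth_step ((0 - c) / e))) {0..L}"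
    using DERIV_smooth_step_scaled[OF e, of c] c e
    by (intro fundamental_theorem_of_calculus)
       (auto simp: has_real_derivative_iff_has_vector_derivative[symmetric] intro: has_field_derivative_at_within)
  moreover have "smooth_step ((L - c) / e) = 1" "smooth_step ((0 - c) / e) = 0"
    using c e by (auto intro!: smooth_step_1 smooth_step_0 simp: field_simps)
  ultimately have w1: "(?w has_integral 1) {0..L}" by simp
  have "((\<lambda>t. ?w t *\<^sub>R T c) has_integral 1 *\<^sub>R T c) {0..L}"
    by (rule has_integral_scaleR_left[OF w1])
  moreover have iT: "(\<lambda>t. ?w t *\<^sub>R T t) integrable_on {0..L}"
    by (intro integrable_continuous_real continuous_intros cw T)
  ultimately have "((\<lambda>t. ?w t *\<^sub>R T t - ?w t *\<^sub>R T c) has_integral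
      (integral {0..L} (\<lambda>t. ?w t *\<^sub>R T t) - 1 *\<^sub>R T c)) {0..L}"
    by (intro has_integral_diff integrable_integral)
  then have eq: "((\<lambda>t. ?w t *\<^sub>R (T t - T c)) has_integral
      (integral {0..L} (\<lambda>t. ?w t *\<^sub>R T t) - T c)) {0..L}"
    by (simp add: scaleR_right_diff_distrib)
  have wn: "((\<lambda>t. ?w t * \<eta>) has_integral 1 * \<eta>) {0..L}"
    by (rule has_integral_mult_left[OF w1])
  have "norm (integral {0..L} (\<lambda>t. ?w t *\<^sub>R (T t - T c))) \<le> integral {0..L} (\<lambda>t. ?w t * \<eta>)"
  proof (rule integral_norm_bound_integral)
    show "norm (?w t *\<^sub>R (T t - T c)) \<le> ?w t * \<eta>" if "t \<in> {0..L}" for t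
    proof (cases "t \<in> {c..c + 2 * e}")
      case True
      then show ?thesis using osc[OF True] e hat_nonneg[of "(t - c) / e"]
        by (simp add: mult_left_mono divide_right_mono)
    next
      case False
      then have "(t - c) / e \<notin> {0..2}" using e by (auto simp: field_simps)
      then show ?thesis using hat_eq_0 by simp
    qed
  qed (use eq wn in auto)
  then show ?thesis
    unfolding integral_unique[OF eq] integral_unique[OF wn] by simp
qed

text \<open>Testing against a smoothed indicator of \<open>[a, b]\<close> compares averages of \<open>T\<close> near \<open>a\<close> and near
  \<open>b\<close> with an integral of \<open>W\<close> over \<open>[a, b]\<close>.\<close>

lemma weak_derivative_lipschitz_interior:
  fixes T W :: "real \<Rightarrow> complex"
  assumes T: "continuous_on {0..L} T" and weak: "weak_derivative L T W" and W: "W \<in> L_inf L"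
    and bound: "AE s in lebesgue. s \<in> {0<..<L} \<longrightarrow> norm (W s) \<le> K"
    and K: "0 \<le> K" and a: "0 < a" and ab: "a < b" and b: "b < L"
  shows "norm (T b - T a) \<le> K * (b - a)"
proof (rule field_le_epsilon)
  fix \<eta>' :: real assume "\<eta>' > 0"
  define \<eta> where "\<eta> = \<eta>' / 3"
  have \<eta>: "\<eta> > 0" using \<open>\<eta>' > 0\<close> by (simp add: \<eta>_def)
  have cont: "\<exists>d>0. \<forall>t\<in>{0..L}. dist t c < d \<longrightarrow> dist (T t) (T c) < \<eta>" if "c \<in> {0..L}" for c
    using T that \<eta> unfolding continuous_on_iff by blast
  obtain da where da: "da > 0" "\<And>t. t \<in> {0..L} \<Longrightarrow> dist t a < da \<Longrightarrow> dist (T t) (T a) < \<eta>"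
    using cont[of a] a ab b by auto
  obtain db where db: "db > 0" "\<And>t. t \<in> {0..L} \<Longrightarrow> dist t b < db \<Longrightarrow> dist (T t) (T b) < \<eta>"
    using cont[of b] a ab b by auto
  define q where "q = \<eta> / (2 * (K + 1))"
  have q: "0 < q" using \<eta> K by (simp add: q_def)
  \<comment> \<open>the width of the smoothing: the bumps stay in the neighbourhoods where \<open>T\<close> is within \<open>\<eta>\<close> of
    its value, and the error \<open>2 K e\<close> in the integral of \<open>W\<close> is at most \<open>\<eta>\<close>\<close>
  define e where "e = min (min (da / 4) (db / 4)) (min ((L - b) / 4) q)"
  have e0: "0 < e" using da(1) db(1) b q by (simp add: e_def)
  have "e \<le> da / 4" "e \<le> db / 4" "e \<le> (L - b) / 4" "e \<le> q"
    unfolding e_def by linarith+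
  then have e: "0 < e" "2 * e < da" "2 * e < db" "b + 2 * e < L" "e \<le> \<eta> / (2 * (K + 1))"
    using e0 by (simp_all add: q_def)
  have "2 * K * e \<le> 2 * (K + 1) * e" using e(1) by (intro mult_right_mono) auto
  also have "\<dots> \<le> \<eta>" using e(5) K by (simp add: field_simps)
  finally have Ke: "2 * K * e \<le> \<eta>" .
  define f where "f t = smooth_step ((t - a) / e) - smooth_step ((t - b) / e)" for t
  let ?w = "\<lambda>c t. hat ((t - c) / e) / e"
  have Df: "(f has_real_derivative ?w a t - ?w b t) (at t)" for t
    unfolding f_def[abs_def] by (intro DERIV_diff DERIV_smooth_step_scaled e)
  have f_supp: "f t = 0" if "t \<notin> {a..b + 2 * e}" for t
  proof (cases "t < a")
    case True
    then show ?thesis using ab e(1) by (simp add: f_def smooth_step_0 divide_nonpos_pos)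
  next
    case False
    then have "2 \<le> (t - a) / e" "2 \<le> (t - b) / e"
      using that ab e(1) by (auto simp: field_simps)
    then show ?thesis by (simp add: f_def smooth_step_1)
  qed
  have f_bound: "0 \<le> f t" "f t \<le> 1" for t
  proof -
    have "(t - b) / e \<le> (t - a) / e" using ab e(1) by (simp add: divide_right_mono)
    then show "0 \<le> f t" using smooth_step_mono by (simp add: f_def)
    show "f t \<le> 1" using smooth_step_bounds[of "(t - a) / e"] smooth_step_bounds[of "(t - b) / e"]
      by (simp add: f_def)
  qed
  have test: "f \<in> test_functions L"
  proof -
    have "{t. f t \<noteq> 0} \<subseteq> {a..b + 2 * e}" using f_supp by blast
    then have "closure {t. f t \<noteq> 0} \<subseteq> {a..b + 2 * e}"
      by (intro closure_minimal) auto
    moreover from this have "compact (closure {t. f t \<noteq> 0})"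
      by (meson bounded_closed_interval bounded_subset closed_closure compact_eq_bounded_closed)
    moreover have "f C1_differentiable_on UNIV"
      unfolding C1_differentiable_on_def
    proof (intro exI conjI ballI)
      show "(f has_vector_derivative ?w a t - ?w b t) (at t)" for t
        using Df by (simp add: has_real_derivative_iff_has_vector_derivative)
      show "continuous_on UNIV (\<lambda>t. ?w a t - ?w b t)"
        by (intro continuous_on_diff continuous_on_hat_scaled)
    qed
    ultimately show ?thesis using a e(4) by (auto simp: test_functions_def)
  qed
  have deriv_f: "deriv f t = ?w a t - ?w b t" for t
    using Df by (rule DERIV_imp_deriv)
  have iw: "(\<lambda>t. ?w c t *\<^sub>R T t) integrable_on {0..L}" for c
    by (intro integrable_continuous_real continuous_intros continuous_on_hat_scaled T)
  have "set_integrable lebesgue {0<..<L} (\<lambda>t. deriv f t *\<^sub>R T t)"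
    by (intro L_inf_scaleR_integrable continuous_in_L_inf T)
       (simp add: deriv_f continuous_on_diff continuous_on_hat_scaled)
  then have "set_lebesgue_integral lebesgue {0<..<L} (\<lambda>t. deriv f t *\<^sub>R T t)
      = integral {0..L} (\<lambda>t. deriv f t *\<^sub>R T t)"
    by (simp add: set_lebesgue_integral_eq_integral(2) integral_open_interval_real)
  also have "\<dots> = integral {0..L} (\<lambda>t. ?w a t *\<^sub>R T t) - integral {0..L} (\<lambda>t. ?w b t *\<^sub>R T t)"
    by (subst integral_diff[symmetric]) (auto simp: deriv_f scaleR_left_diff_distrib iw)
  finally have lhs: "set_lebesgue_integral lebesgue {0<..<L} (\<lambda>t. deriv f t *\<^sub>R T t)
      = integral {0..L} (\<lambda>t. ?w a t *\<^sub>R T t) - integral {0..L} (\<lambda>t. ?w b t *\<^sub>R T t)" .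
  have "norm (set_lebesgue_integral lebesgue {0<..<L} (\<lambda>t. f t *\<^sub>R W t))
      \<le> (\<integral>t. norm (indicator {0<..<L} t *\<^sub>R f t *\<^sub>R W t) \<partial>lebesgue)"
    unfolding set_lebesgue_integral_def by (rule integral_norm_bound)
  also have "\<dots> \<le> (\<integral>t. indicator {a..b + 2 * e} t * K \<partial>lebesgue)"
  proof (rule integral_mono_AE')
    show "integrable lebesgue (\<lambda>t. indicator {a..b + 2 * e} t * K)"
      by (intro integrable_mult_left integrable_real_indicator) (use ab e in auto)
    show "AE t in lebesgue. norm (indicator {0<..<L} t *\<^sub>R f t *\<^sub>R W t) \<le> indicator {a..b + 2 * e} t * K"
      using bound
    proof eventually_elim
      case (elim t)
      show ?case
      proof (cases "t \<in> {a..b + 2 * e}")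
        case True
        then have "norm (W t) \<le> K" "t \<in> {0<..<L}" using elim a e(4) by auto
        moreover have "\<bar>f t\<bar> * norm (W t) \<le> 1 * K"
          using f_bound[of t] calculation by (intro mult_mono) auto
        ultimately show ?thesis using True by simp
      next
        case False
        then show ?thesis using f_supp[OF False] by simp
      qed
    qed
  qed (use K in auto)
  also have "\<dots> = K * (b - a) + 2 * K * e"
    using ab e(1) by (simp add: algebra_simps)
  finally have rhs: "norm (set_lebesgue_integral lebesgue {0<..<L} (\<lambda>t. f t *\<^sub>R W t)) \<le> K * (b - a) + 2 * K * e" .
  have "norm (integral {0..L} (\<lambda>t. ?w a t *\<^sub>R T t) - integral {0..L} (\<lambda>t. ?w b t *\<^sub>R T t)) \<le> K * (b - a) + \<eta>"
  proof -
    have "integral {0..L} (\<lambda>t. ?w a t *\<^sub>R T t) - integral {0..L} (\<lambda>t. ?w b t *\<^sub>R T t)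
        = - set_lebesgue_integral lebesgue {0<..<L} (\<lambda>t. f t *\<^sub>R W t)"
      using weak test lhs by (simp add: weak_derivative_def)
    then show ?thesis using rhs Ke by (simp only: norm_minus_cancel)
  qed
  moreover have "norm (integral {0..L} (\<lambda>t. ?w a t *\<^sub>R T t) - T a) \<le> \<eta>"
    using da(2) e a ab by (intro hat_average T) (auto simp: dist_norm intro!: less_imp_le)
  moreover have "norm (integral {0..L} (\<lambda>t. ?w b t *\<^sub>R T t) - T b) \<le> \<eta>"
    using db(2) e a ab by (intro hat_average T) (auto simp: dist_norm intro!: less_imp_le)
  moreover have "norm (T b - T a) \<le> norm (Ia - Ib) + norm (Ia - T a) + norm (Ib - T b)" for Ia Ib
    by norm
  ultimately have "norm (T b - T a) \<le> K * (b - a) + 3 * \<eta>"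
    by (smt (verit))
  then show "norm (T b - T a) \<le> K * (b - a) + \<eta>'" by (simp add: \<eta>_def)
qed

text \<open>The continuous representative of a function in \<open>W\<^sup>1\<^sup>,\<^sup>\<infinity>\<close> is Lipschitz up to the end points.\<close>

lemma weak_derivative_lipschitz:
  fixes T W :: "real \<Rightarrow> complex"
  assumes T: "continuous_on {0..L} T" and weak: "weak_derivative L T W" and W: "W \<in> L_inf L"
    and bound: "AE s in lebesgue. s \<in> {0<..<L} \<longrightarrow> norm (W s) \<le> K"
    and K: "0 \<le> K" and a: "0 \<le> a" and ab: "a \<le> b" and b: "b \<le> L"
  shows "norm (T b - T a) \<le> K * (b - a)"
proof (cases "a = b")
  case False
  define c where "c = (b - a) / 2"
  have c: "0 < c" using False ab by (simp add: c_def)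
  define g where "g d = K * ((b - d) - (a + d)) - norm (T (b - d) - T (a + d))" for d
  have "0 \<le> g 0"
  proof (rule continuous_ge_on_closure[where S = "{0<..<c}" and f = g and a = 0 and x = 0])
    show "continuous_on (closure {0<..<c}) g"
      unfolding g_def using c a b
      by (intro continuous_intros continuous_on_compose2[OF T]) (auto simp: c_def field_simps)
    show "0 \<in> closure {0<..<c}" using c by simp
    show "0 \<le> g d" if "d \<in> {0<..<c}" for d
      using weak_derivative_lipschitz_interior[OF T weak W bound K, of "a + d" "b - d"] that a b
      by (auto simp: g_def c_def)
  qed
  then show ?thesis by (simp add: g_def)
qed auto

section \<open>Tangent angles\<close>

lemma norm_cis_diff: "norm (cis u - cis v) = 2 * \<bar>sin ((u - v) / 2)\<bar>"
proof -
  have "cis u - cis v = cis ((u+v)/2) * (cis ((u-v)/2) - cis (-((u-v)/2)))"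
    by (simp add: right_diff_distrib cis_mult field_simps)
  also have "norm \<dots> = norm (cis ((u-v)/2) - cis (-((u-v)/2)))"
    by (simp add: norm_mult)
  also have "cis ((u-v)/2) - cis (-((u-v)/2)) = \<i> * of_real (2 * sin ((u-v)/2))"
    by (simp add: complex_eq_iff)
  finally show ?thesis by (simp add: norm_mult)
qed

lemma sin_lower_bound_near_zero:
  fixes c :: real
  assumes "c < 1"
  obtains \<eta> where "\<eta> > 0" "\<And>x. \<bar>x\<bar> < \<eta> \<Longrightarrow> c * \<bar>x\<bar> \<le> \<bar>sin x\<bar>"
proof -
  have "(\<lambda>h. (sin (0 + h) - sin 0) / h) \<midarrow>0\<rightarrow> (1::real)"
    using DERIV_sin[of "0::real"] by (simp add: DERIV_def)
  then have "\<forall>\<^sub>F h in at (0::real). c < sin h / h"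
    using assms by (intro order_tendstoD(1)) auto
  then obtain \<eta> where \<eta>: "\<eta> > 0" "\<And>x. x \<noteq> 0 \<Longrightarrow> \<bar>x\<bar> < \<eta> \<Longrightarrow> c < sin x / x"
    by (auto simp: eventually_at dist_real_def)
  have "c * \<bar>x\<bar> \<le> \<bar>sin x\<bar>" if "\<bar>x\<bar> < \<eta>" for x
  proof (cases "x = 0")
    case False
    then have "c \<le> \<bar>sin x\<bar> / \<bar>x\<bar>" using \<eta>(2)[of x] that
      by (metis abs_divide abs_ge_self less_eq_real_def order_trans)
    then show ?thesis using False by (simp add: field_simps)
  qed auto
  then show ?thesis using that \<eta>(1) by blast
qed

text \<open>Short chords of the unit circle are asymptotically as long as their arcs, so a Lipschitz bound on
  chords carries over to the angle with the same constant.\<close>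

lemma angle_lipschitz:
  fixes \<phi> :: "real \<Rightarrow> real"
  assumes cont: "continuous_on {a..b} \<phi>" and K: "0 \<le> K"
    and chord: "\<And>s t. s \<in> {a..b} \<Longrightarrow> t \<in> {a..b} \<Longrightarrow> s \<le> t \<Longrightarrow>
      norm (cis (\<phi> t) - cis (\<phi> s)) \<le> K * (t - s)"
    and s: "s \<in> {a..b}" and t: "t \<in> {a..b}"
  shows "\<bar>\<phi> t - \<phi> s\<bar> \<le> K * \<bar>t - s\<bar>"
proof -
  have M: "\<bar>\<phi> t - \<phi> s\<bar> \<le> M * \<bar>t - s\<bar>" if "K < M" for M
  proof -
    define c where "c = (K + M) / (2 * M)"
    have c: "0 < c" "c < 1" "K \<le> c * M"
      using that K by (auto simp: c_def field_simps)
    obtain \<eta> where \<eta>: "\<eta> > 0" "\<And>x. \<bar>x\<bar> < \<eta> \<Longrightarrow> c * \<bar>x\<bar> \<le> \<bar>sin x\<bar>"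
      using sin_lower_bound_near_zero[OF c(2)] by blast
    have "M-lipschitz_on {a..b} \<phi>"
    proof (rule locally_lipschitz_imp_lipschitz[OF cont])
      show "0 \<le> M" using that K by simp
      fix x y :: real assume x: "x \<in> {a..<b}" and y: "x < y"
      have "continuous (at x within {a..b}) \<phi>"
        using cont x by (auto simp: continuous_on_eq_continuous_within)
      then obtain d where d: "d > 0" "\<And>z. z \<in> {a..b} \<Longrightarrow> dist z x < d \<Longrightarrow> dist (\<phi> z) (\<phi> x) < \<eta>"
        using \<eta>(1) by (auto simp: continuous_within_eps_delta)
      define z where "z = min (min y b) (x + d/2)"
      have z: "z \<in> {x<..y}" "z \<in> {a..b}" "dist z x < d"
        using x y d(1) by (auto simp: z_def dist_real_def)
      have "\<bar>(\<phi> z - \<phi> x) / 2\<bar> < \<eta>"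
        using d(2)[OF z(2,3)] \<eta>(1) by (auto simp: dist_real_def)
      then have "c * \<bar>\<phi> z - \<phi> x\<bar> \<le> 2 * \<bar>sin ((\<phi> z - \<phi> x) / 2)\<bar>"
        using \<eta>(2) by fastforce
      also have "\<dots> \<le> K * (z - x)"
        using chord[of x z] z x by (simp add: norm_cis_diff)
      also have "\<dots> \<le> c * M * (z - x)"
        using c(3) z(1) by (intro mult_right_mono) auto
      finally have "\<bar>\<phi> z - \<phi> x\<bar> \<le> M * (z - x)"
        using c(1) by (simp add: mult.assoc)
      then show "\<exists>z\<in>{x<..y}. dist (\<phi> z) (\<phi> x) \<le> M * (z - x)"
        using z(1) by (auto simp: dist_real_def)
    qed
    then show ?thesis
      using lipschitz_onD[of M "{a..b}" \<phi> t s] s t by (simp add: dist_real_def)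
  qed
  have "((\<lambda>M. M * \<bar>t - s\<bar>) \<longlongrightarrow> K * \<bar>t - s\<bar>) (at_right K)"
    by (intro tendsto_intros)
  moreover have "\<forall>\<^sub>F M in at_right K. \<bar>\<phi> t - \<phi> s\<bar> \<le> M * \<bar>t - s\<bar>"
    using M by (auto simp: eventually_at_right_field intro: exI[of _ "K + 1"])
  ultimately show ?thesis
    by (rule tendsto_lowerbound) auto
qed

lemma continuous_angle_exists:
  fixes T :: "real \<Rightarrow> complex"
  assumes cont: "continuous_on {0..L} T" and "0 \<le> L" and norm: "\<And>s. s \<in> {0..L} \<Longrightarrow> norm (T s) = 1"
  obtains \<phi> where "continuous_on {0..L} \<phi>" "\<phi> 0 = 0" "\<And>s. s \<in> {0..L} \<Longrightarrow> T s = T 0 * cis (\<phi> s)"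
proof -
  obtain g where g: "continuous_on {0..L} g" "\<And>s. s \<in> {0..L} \<Longrightarrow> T s = exp (g s)"
    by (rule continuous_logarithm_on_contractible[OF cont]) (use norm in \<open>force intro: convex_imp_contractible\<close>)+
  have Re: "Re (g s) = 0" if "s \<in> {0..L}" for s
    using norm[OF that] g(2)[OF that] by simp
  have T: "T s = cis (Im (g s))" if "s \<in> {0..L}" for s
    using g(2)[OF that] Re[OF that] by (simp add: exp_eq_polar)
  show ?thesis
  proof
    show "continuous_on {0..L} (\<lambda>s. Im (g s) - Im (g 0))"
      by (intro continuous_intros g)
    show "T s = T 0 * cis (Im (g s) - Im (g 0))" if "s \<in> {0..L}" for s
      using T[OF that] T[of 0] \<open>0 \<le> L\<close> by (simp add: cis_mult)
  qed simp
qed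

lemma angle_constant:
  fixes g :: "real \<Rightarrow> real"
  assumes "continuous_on {a..b} g" and "\<And>s. s \<in> {a..b} \<Longrightarrow> cis (g s) = z"
    and "s \<in> {a..b}" "t \<in> {a..b}"
  shows "g s = g t"
  using angle_lipschitz[OF assms(1), of 0 s t] assms(2-) by simp

section \<open>Arc-line-arc curves: the tangent angle\<close>

text \<open>The tangent angle of a curve turning left with radius \<open>R\<close> on \<open>[0, m1]\<close>, straight on
  \<open>[m1, m2]\<close>, and turning left with radius \<open>R\<close> from \<open>m2\<close> on.\<close>

definition arc_line_arc :: "real \<Rightarrow> real \<Rightarrow> real \<Rightarrow> real \<Rightarrow> real" where
  "arc_line_arc R m1 m2 s = (min s m1 + max 0 (s - m2)) / R"

lemma continuous_on_arc_line_arc: "continuous_on S (arc_line_arc R m1 m2)"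
proof (cases "R = 0")
  case False
  then show ?thesis
    unfolding arc_line_arc_def[abs_def] by (intro continuous_intros) auto
qed (simp add: arc_line_arc_def[abs_def])

lemma arc_line_arc_mono:
  assumes "0 < R" "s \<le> t"
  shows "arc_line_arc R m1 m2 s \<le> arc_line_arc R m1 m2 t"
  using assms by (auto simp: arc_line_arc_def intro!: divide_right_mono add_mono)

lemma has_vector_derivative_cis:
  assumes "(g has_real_derivative g') (at t within S)"
  shows "((\<lambda>t. cis (g t)) has_vector_derivative g' *\<^sub>R (\<i> * cis (g t))) (at t within S)"
proof -
  have "((\<lambda>t. Complex (cos (g t)) (sin (g t))) has_vector_derivative
      Complex (- (sin (g t) * g')) (cos (g t) * g')) (at t within S)"
    using assms unfolding has_vector_derivative_complex_iff
    by (auto intro!: derivative_eq_intros simp: has_real_derivative_iff_has_vector_derivative[symmetric])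
  moreover have "(\<lambda>t. Complex (cos (g t)) (sin (g t))) = (\<lambda>t. cis (g t))"
    by (simp add: fun_eq_iff complex_eq_iff)
  moreover have "Complex (- (sin (g t) * g')) (cos (g t) * g') = g' *\<^sub>R (\<i> * cis (g t))"
    by (simp add: complex_eq_iff)
  ultimately show ?thesis by simp
qed

text \<open>Off the two junctions, the angle has slope \<open>1/R\<close> or \<open>0\<close>.\<close>

definition arc_line_arc_slope :: "real \<Rightarrow> real \<Rightarrow> real \<Rightarrow> real \<Rightarrow> real" where
  "arc_line_arc_slope R m1 m2 s = (if s < m1 \<or> m2 < s then 1 / R else 0)"

lemma arc_line_arc_has_derivative:
  assumes "m1 \<le> m2" and "s \<noteq> m1" "s \<noteq> m2"
  shows "(arc_line_arc R m1 m2 has_real_derivative arc_line_arc_slope R m1 m2 s) (at s)"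
proof -
  consider "s < m1" | "m1 < s" "s < m2" | "m2 < s" using assms by linarith
  then show ?thesis
  proof cases
    case 1
    have "((\<lambda>s. s / R) has_real_derivative 1 / R) (at s)"
      by (cases "R = 0") (auto intro!: derivative_eq_intros)
    then have "(arc_line_arc R m1 m2 has_real_derivative 1 / R) (at s)"
      by (rule has_field_derivative_transform_within_open[of _ _ _ "{..<m1}"])
         (use 1 assms in \<open>auto simp: arc_line_arc_def\<close>)
    then show ?thesis using 1 by (simp add: arc_line_arc_slope_def)
  next
    case 2
    have "((\<lambda>s. m1 / R) has_real_derivative 0) (at s)" by simp
    then have "(arc_line_arc R m1 m2 has_real_derivative 0) (at s)"
      by (rule has_field_derivative_transform_within_open[of _ _ _ "{m1<..<m2}"])
         (use 2 assms in \<open>auto simp: arc_line_arc_def\<close>)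
    then show ?thesis using 2 by (simp add: arc_line_arc_slope_def)
  next
    case 3
    have "((\<lambda>s. (m1 + (s - m2)) / R) has_real_derivative 1 / R) (at s)"
      by (cases "R = 0") (auto intro!: derivative_eq_intros)
    then have "(arc_line_arc R m1 m2 has_real_derivative 1 / R) (at s)"
      by (rule has_field_derivative_transform_within_open[of _ _ _ "{m2<..}"])
         (use 3 assms in \<open>auto simp: arc_line_arc_def\<close>)
    then show ?thesis using 3 by (simp add: arc_line_arc_slope_def)
  qed
qed

text \<open>The primitive of the unit tangent of an arc-line-arc curve: the circular part contributes
  \<open>R (cis \<phi> - 1) / \<i>\<close>, the straight part, of length \<open>s - R \<phi> s\<close> so far, points in the
  direction \<open>cis (m1 / R)\<close>.\<close>

lemma integral_arc_line_arc:
  assumes R: "0 < R" and m: "0 \<le> m1" "m1 \<le> m2" and s: "0 \<le> s"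
  shows "((\<lambda>t. cis (arc_line_arc R m1 m2 t)) has_integral
     (- (\<i> * R) * (cis (arc_line_arc R m1 m2 s) - 1) +
      (s - R * arc_line_arc R m1 m2 s) *\<^sub>R cis (m1 / R))) {0..s}"
proof -
  let ?p = "arc_line_arc R m1 m2"
  let ?F = "\<lambda>t. - (\<i> * R) * (cis (?p t) - 1) + (t - R * ?p t) *\<^sub>R cis (m1 / R)"
  have "((\<lambda>t. cis (?p t)) has_integral (?F s - ?F 0)) {0..s}"
  proof (rule fundamental_theorem_of_calculus_interior_strong[where S = "{m1, m2}"])
    show "continuous_on {0..s} ?F"
      unfolding cis_conv_exp by (intro continuous_intros continuous_on_arc_line_arc)
    fix t assume t: "t \<in> {0<..<s} - {m1, m2}"
    then have d: "(?p has_real_derivative arc_line_arc_slope R m1 m2 t) (at t)"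
      using m by (intro arc_line_arc_has_derivative) auto
    have "(?F has_vector_derivative
        - (\<i> * R) * (arc_line_arc_slope R m1 m2 t *\<^sub>R (\<i> * cis (?p t)) - 0) +
        (1 - R * arc_line_arc_slope R m1 m2 t) *\<^sub>R cis (m1 / R)) (at t)"
    proof (intro has_vector_derivative_add has_vector_derivative_mult_right has_vector_derivative_diff
        has_vector_derivative_cis d has_vector_derivative_const)
      have "((\<lambda>t. t - R * ?p t) has_real_derivative 1 - R * arc_line_arc_slope R m1 m2 t) (at t)"
        by (auto intro!: derivative_eq_intros d)
      from has_vector_derivative_scaleR[OF this has_vector_derivative_const]
      show "((\<lambda>t. (t - R * ?p t) *\<^sub>R cis (m1 / R)) has_vector_derivative
          (1 - R * arc_line_arc_slope R m1 m2 t) *\<^sub>R cis (m1 / R)) (at t)" by simp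
    qed
    moreover have "- (\<i> * R) * (arc_line_arc_slope R m1 m2 t *\<^sub>R (\<i> * cis (?p t)) - 0) +
        (1 - R * arc_line_arc_slope R m1 m2 t) *\<^sub>R cis (m1 / R) = cis (?p t)"
    proof (cases "t < m1 \<or> m2 < t")
      case True
      then show ?thesis using R by (simp add: arc_line_arc_slope_def scaleR_conv_of_real)
    next
      case False
      then have "?p t = m1 / R" using m t by (simp add: arc_line_arc_def)
      then show ?thesis using False by (simp add: arc_line_arc_slope_def)
    qed
    ultimately show "(?F has_vector_derivative cis (?p t)) (at t)" by simp
  qed (use s in auto)
  moreover have "?p 0 = 0" using m by (simp add: arc_line_arc_def)
  ultimately show ?thesis by simp
qed

section \<open>The cost of turning\<close>

lemma has_integral_cos_diff:
  assumes "((\<lambda>t. cis (\<phi> t)) has_integral I) S"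
  shows "((\<lambda>t. cos (\<phi> t - \<psi>)) has_integral Re (cis (- \<psi>) * I)) S"
proof -
  have "bounded_linear (\<lambda>z. Re (cis (- \<psi>) * z))"
    by (intro bounded_linear_compose[OF bounded_linear_Re] bounded_linear_mult_right)
  from has_integral_linear[OF assms this] show ?thesis
    by (simp add: o_def cos_diff algebra_simps)
qed

lemma cos_le_cos_abs: "\<bar>x\<bar> \<le> \<bar>y\<bar> \<Longrightarrow> \<bar>y\<bar> \<le> pi \<Longrightarrow> cos y \<le> cos (x::real)"
  using cos_monotone_0_pi_le[of "\<bar>x\<bar>" "\<bar>y\<bar>"] by simp

lemma cos_gt_minus_one: "\<bar>x\<bar> < pi \<Longrightarrow> - 1 < cos (x::real)"
  using cos_monotone_0_pi[of "\<bar>x\<bar>" pi] by simp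

lemma has_integral_cos_scaled:
  fixes R a b c :: real
  assumes "0 < R" "a \<le> b"
  shows "((\<lambda>s. cos ((s - c) / R)) has_integral R * (sin ((b - c) / R) - sin ((a - c) / R))) {a..b}"
proof -
  have "((\<lambda>s. R * sin ((s - c) / R)) has_real_derivative cos ((s - c) / R)) (at s within {a..b})" for s
    using assms by (auto intro!: derivative_eq_intros)
  then show ?thesis
    using fundamental_theorem_of_calculus[OF \<open>a \<le> b\<close>, of "\<lambda>s. R * sin ((s - c) / R)"]
    by (simp add: has_real_derivative_iff_has_vector_derivative right_diff_distrib)
qed

text \<open>An angle function passing through the direction opposite to \<open>\<psi>\<close> must turn there from \<open>0\<close> and
  back to \<open>\<Omega>\<close> modulo \<open>2\<pi>\<close>. Near that time \<open>\<phi>\<close> is far from \<open>\<psi>\<close>, which alone costs more than the bound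
  in \<open>angle_cost\<close>.\<close>

lemma angle_cost_antipode:
  fixes \<phi> :: "real \<Rightarrow> real"
  assumes R: "0 < R" and cont: "continuous_on {0..L} \<phi>"
    and lip: "\<And>s t. s \<in> {0..L} \<Longrightarrow> t \<in> {0..L} \<Longrightarrow> \<bar>\<phi> t - \<phi> s\<bar> \<le> \<bar>t - s\<bar> / R"
    and start: "\<phi> 0 = 0" and final: "cis (\<phi> L) = cis \<Omega>"
    and \<psi>: "0 \<le> \<psi>" "\<psi> \<le> \<Omega>" "\<Omega> < pi"
    and r: "r \<in> {0..L}" "cos (\<phi> r - \<psi>) = -1"
  shows "R * (2 * pi - \<Omega> + sin \<psi> + sin (\<Omega> - \<psi>)) \<le> integral {0..L} (\<lambda>s. 1 - cos (\<phi> s - \<psi>))"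
proof -
  \<comment> \<open>\<open>u\<close> and \<open>v\<close> bound the time interval around \<open>r\<close> that is needed to turn from the initial
    direction to the opposite of \<open>\<psi>\<close>, and from there to the final direction\<close>
  define u where "u = r - R * (pi - \<psi>)"
  define v where "v = r + R * (pi - (\<Omega> - \<psi>))"
  have before: "pi - \<psi> \<le> \<bar>\<phi> r\<bar>"
  proof (rule ccontr)
    assume "\<not> ?thesis"
    then have "\<bar>\<phi> r - \<psi>\<bar> < pi" using \<psi> by linarith
    then show False using cos_gt_minus_one r(2) by fastforce
  qed
  have "cis (\<Omega> - \<psi> - (\<phi> L - \<phi> r)) = cis \<Omega> / cis (\<phi> L) * cis (\<phi> r - \<psi>)"
    by (simp add: cis_divide cis_mult algebra_simps)
  then have "cis (\<Omega> - \<psi> - (\<phi> L - \<phi> r)) = cis (\<phi> r - \<psi>)" using final by simp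
  then have eq: "cos (\<Omega> - \<psi> - (\<phi> L - \<phi> r)) = -1"
    using r(2) by (metis cis.simps(1))
  have after: "pi - (\<Omega> - \<psi>) \<le> \<bar>\<phi> L - \<phi> r\<bar>"
  proof (rule ccontr)
    assume "\<not> ?thesis"
    then have "\<bar>\<Omega> - \<psi> - (\<phi> L - \<phi> r)\<bar> < pi" using \<psi> by linarith
    then show False using cos_gt_minus_one eq by fastforce
  qed
  have "pi - \<psi> \<le> r / R" using before lip[of 0 r] start r(1) by auto
  then have u: "0 \<le> u" using R by (simp add: u_def field_simps)
  have "pi - (\<Omega> - \<psi>) \<le> (L - r) / R" using after lip[of r L] r(1) by auto
  then have v: "v \<le> L" using R by (simp add: v_def field_simps)
  have uv: "u \<le> v"
  proof -
    have "0 \<le> R * (pi - \<psi>)" "0 \<le> R * (pi - (\<Omega> - \<psi>))"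
      using R \<psi> by (auto intro!: mult_nonneg_nonneg)
    then show ?thesis by (simp add: u_def v_def)
  qed
  have sin0: "sin (\<phi> r - \<psi>) = 0"
    using r(2) sin_cos_squared_add[of "\<phi> r - \<psi>"] by simp
  have pointwise: "1 + cos ((s - r) / R) \<le> 1 - cos (\<phi> s - \<psi>)" if s: "s \<in> {u..v}" for s
  proof -
    have "s - r \<le> R * (pi - (\<Omega> - \<psi>))" "r - s \<le> R * (pi - \<psi>)" using s by (auto simp: u_def v_def)
    moreover have "R * (pi - (\<Omega> - \<psi>)) \<le> R * pi" "R * (pi - \<psi>) \<le> R * pi"
      using R \<psi> by (auto intro!: mult_left_mono)
    ultimately have "\<bar>s - r\<bar> \<le> R * pi" by linarith
    then have "\<bar>(s - r) / R\<bar> \<le> pi" using R by (simp add: field_simps)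
    moreover have "\<bar>\<phi> s - \<phi> r\<bar> \<le> \<bar>(s - r) / R\<bar>" using lip[of r s] s u v r(1) R by simp
    ultimately have "cos ((s - r) / R) \<le> cos (\<phi> s - \<phi> r)"
      by (intro cos_le_cos_abs)
    moreover have "cos (\<phi> s - \<psi>) = cos ((\<phi> s - \<phi> r) + (\<phi> r - \<psi>))" by simp
    then have "cos (\<phi> s - \<psi>) = - cos (\<phi> s - \<phi> r)"
      unfolding cos_add using r(2) sin0 by simp
    ultimately show ?thesis by simp
  qed
  have "((\<lambda>s. 1 + cos ((s - r) / R)) has_integral
      1 * (v - u) + R * (sin ((v - r) / R) - sin ((u - r) / R))) {u..v}"
    using has_integral_const_real[of "1::real" u v] uv
    by (intro has_integral_add has_integral_cos_scaled R) auto
  moreover have "1 * (v - u) + R * (sin ((v - r) / R) - sin ((u - r) / R)) =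
      R * (2 * pi - \<Omega> + sin \<psi> + sin (\<Omega> - \<psi>))"
  proof -
    have "sin ((v - r) / R) = sin (pi - (\<Omega> - \<psi>))" using R by (simp add: v_def)
    also have "\<dots> = sin (\<Omega> - \<psi>)" by (rule sin_pi_minus)
    finally have v_sin: "sin ((v - r) / R) = sin (\<Omega> - \<psi>)" .
    have "sin ((u - r) / R) = sin (- (pi - \<psi>))" using R by (simp add: u_def)
    also have "\<dots> = - sin \<psi>" by (simp only: sin_minus sin_pi_minus)
    finally have u_sin: "sin ((u - r) / R) = - sin \<psi>" .
    show ?thesis unfolding v_sin u_sin by (simp add: u_def v_def algebra_simps)
  qed
  ultimately have int: "((\<lambda>s. 1 + cos ((s - r) / R)) has_integral
      R * (2 * pi - \<Omega> + sin \<psi> + sin (\<Omega> - \<psi>))) {u..v}" by simp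
  then have int1: "(\<lambda>s. 1 + cos ((s - r) / R)) integrable_on {u..v}" by blast
  have "R * (2 * pi - \<Omega> + sin \<psi> + sin (\<Omega> - \<psi>)) = integral {u..v} (\<lambda>s. 1 + cos ((s - r) / R))"
    using int by (simp add: integral_unique)
  also have "\<dots> \<le> integral {u..v} (\<lambda>s. 1 - cos (\<phi> s - \<psi>))"
    using u v pointwise
    by (intro integral_le int1 integrable_continuous_real continuous_intros continuous_on_subset[OF cont]) auto
  also have "\<dots> \<le> integral {0..L} (\<lambda>s. 1 - cos (\<phi> s - \<psi>))"
    using u v
    by (intro integral_subset_le integrable_continuous_real continuous_intros continuous_on_subset[OF cont]) auto
  finally show ?thesis .
qed

text \<open>The integral is the excess of the length of the curve over its displacement in the direction
  \<open>\<psi>\<close>. The optimal angle function turns at full speed to \<open>\<psi>\<close>, stays there, and turns at full speed to \<open>\<Omega>\<close> as late as possible.\<close>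

lemma angle_cost:
  fixes \<phi> :: "real \<Rightarrow> real"
  assumes R: "0 < R" and L: "0 < L" and cont: "continuous_on {0..L} \<phi>"
    and lip: "\<And>s t. s \<in> {0..L} \<Longrightarrow> t \<in> {0..L} \<Longrightarrow> \<bar>\<phi> t - \<phi> s\<bar> \<le> \<bar>t - s\<bar> / R"
    and start: "\<phi> 0 = 0" and final: "cis (\<phi> L) = cis \<Omega>"
    and \<psi>: "0 \<le> \<psi>" "\<psi> \<le> \<Omega>" "\<Omega> < pi"
  shows "R * (\<Omega> - sin \<psi> - sin (\<Omega> - \<psi>)) \<le> integral {0..L} (\<lambda>s. 1 - cos (\<phi> s - \<psi>))"
    and "integral {0..L} (\<lambda>s. 1 - cos (\<phi> s - \<psi>)) = R * (\<Omega> - sin \<psi> - sin (\<Omega> - \<psi>)) \<Longrightarrow>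
      s \<in> {0..L} \<Longrightarrow> \<phi> s = arc_line_arc R (R * \<psi>) (L - R * (\<Omega> - \<psi>)) s"
proof -
  let ?cost = "integral {0..L} (\<lambda>s. 1 - cos (\<phi> s - \<psi>))"
  let ?c = "R * (\<Omega> - sin \<psi> - sin (\<Omega> - \<psi>))"
  let ?p = "arc_line_arc R (R * \<psi>) (L - R * (\<Omega> - \<psi>))"
  have sin_nonneg: "0 \<le> sin \<psi>" "0 \<le> sin (\<Omega> - \<psi>)"
    using \<psi> by (auto intro!: sin_ge_zero)
  have "?c \<le> ?cost \<and> (?cost = ?c \<longrightarrow> (\<forall>s\<in>{0..L}. \<phi> s = ?p s))"
  proof (cases "\<exists>r\<in>{0..L}. cos (\<phi> r - \<psi>) = -1")
    case True
    then obtain r where "r \<in> {0..L}" "cos (\<phi> r - \<psi>) = -1" by blast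
    from angle_cost_antipode[OF R cont lip start final \<psi> this]
    have "R * (2 * pi - \<Omega> + sin \<psi> + sin (\<Omega> - \<psi>)) \<le> ?cost" .
    moreover have "?c < R * (2 * pi - \<Omega> + sin \<psi> + sin (\<Omega> - \<psi>))"
      using R \<psi> sin_nonneg by (intro mult_strict_left_mono) auto
    ultimately show ?thesis by simp
  next
    case False
    have range: "\<bar>\<phi> s - \<psi>\<bar> < pi" if s: "s \<in> {0..L}" for s
    proof (rule ccontr)
      assume far: "\<not> ?thesis"
      have c: "continuous_on {0..s} \<phi>" using cont s by (auto intro: continuous_on_subset)
      consider "\<psi> + pi \<le> \<phi> s" | "\<phi> s \<le> \<psi> - pi" using far by linarith
      then show False
      proof cases
        case 1
        then obtain x where "x \<ge> 0" "x \<le> s" and x: "\<phi> x = \<psi> + pi"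
          using IVT'[of \<phi> 0 "\<psi> + pi" s] start \<psi> s c by auto
        moreover have "cos (\<phi> x - \<psi>) = -1" by (simp add: x)
        ultimately show False using False s by force
      next
        case 2
        then obtain x where "x \<ge> 0" "x \<le> s" and x: "\<phi> x = \<psi> - pi"
          using IVT2'[of \<phi> s "\<psi> - pi" 0] start \<psi> s c by auto
        moreover have "cos (\<phi> x - \<psi>) = -1" by (simp add: x)
        ultimately show False using False s by force
      qed
    qed
    \<comment> \<open>the range is shorter than a full turn around \<open>\<psi>\<close>, so the final angle is \<open>\<Omega>\<close> itself\<close>
    have "\<phi> L = \<Omega>"
    proof -
      have "cos (\<phi> L - \<Omega>) = Re (cis (\<phi> L) / cis \<Omega>)" by (simp add: cis_divide)
      then have "cos (\<phi> L - \<Omega>) = 1" using final by simp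
      then obtain n :: int where n: "\<phi> L - \<Omega> = n * 2 * pi" using cos_one_2pi_int by auto
      have "\<bar>\<phi> L - \<Omega>\<bar> < 1 * (2 * pi)" using range[of L] L \<psi> by auto
      then have "\<bar>real_of_int n\<bar> * (2 * pi) < 1 * (2 * pi)" unfolding n by (simp add: abs_mult)
      then have "\<bar>real_of_int n\<bar> < 1" by (subst (asm) mult_less_cancel_right_pos) auto
      then have "n = 0" by linarith
      then show ?thesis using n by simp
    qed
    have "\<Omega> \<le> L / R" using lip[of 0 L] L \<open>\<phi> L = \<Omega>\<close> start \<psi> by auto
    then have L_ge: "R * \<Omega> \<le> L" using R by (simp add: field_simps)
    have lo: "\<bar>\<phi> s\<bar> \<le> s / R" if "s \<in> {0..L}" for s using lip[of 0 s] that start by simp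
    have hi: "\<Omega> - (L - s) / R \<le> \<phi> s" if "s \<in> {0..L}" for s
      using lip[of s L] that \<open>\<phi> L = \<Omega>\<close> by simp
    have m: "0 \<le> R * \<psi>" "R * \<psi> \<le> L - R * (\<Omega> - \<psi>)" "L - R * (\<Omega> - \<psi>) \<le> L"
      using R \<psi> L_ge by (auto simp: algebra_simps)
    have parts: "(\<phi> s \<le> ?p s \<and> ?p s \<le> \<psi>) \<or> ?p s = \<psi> \<or> (\<psi> \<le> ?p s \<and> ?p s \<le> \<phi> s)"
      if s: "s \<in> {0..L}" for s
    proof -
      consider "s \<le> R * \<psi>" | "R * \<psi> \<le> s" "s \<le> L - R * (\<Omega> - \<psi>)" | "L - R * (\<Omega> - \<psi>) \<le> s"
        by linarith
      then show ?thesis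
      proof cases
        case 1
        then have "?p s = s / R" "s / R \<le> \<psi>" using m R by (auto simp: arc_line_arc_def field_simps)
        then show ?thesis using lo[OF s] by auto
      next
        case 2
        then have "?p s = \<psi>" using m R by (auto simp: arc_line_arc_def)
        then show ?thesis by simp
      next
        case 3
        then have "?p s = \<Omega> - (L - s) / R" using m R by (auto simp: arc_line_arc_def field_simps)
        moreover have "(L - s) / R \<le> \<Omega> - \<psi>" using 3 R by (simp add: field_simps)
        ultimately show ?thesis using hi[OF s] by auto
      qed
    qed
    have pointwise: "1 - cos (?p s - \<psi>) \<le> 1 - cos (\<phi> s - \<psi>)" if s: "s \<in> {0..L}" for s
    proof -
      have "\<bar>?p s - \<psi>\<bar> \<le> \<bar>\<phi> s - \<psi>\<bar>" using parts[OF s] by auto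
      then show ?thesis using range[OF s] cos_le_cos_abs[of "?p s - \<psi>" "\<phi> s - \<psi>"] by simp
    qed
    have "min L (R * \<psi>) = R * \<psi>" "max 0 (L - (L - R * (\<Omega> - \<psi>))) = R * (\<Omega> - \<psi>)" using m by auto
    then have pL: "?p L = \<Omega>" using R by (simp add: arc_line_arc_def field_simps)
    have "((\<lambda>s. 1 - cos (?p s - \<psi>)) has_integral
        1 * (L - 0) - Re (cis (- \<psi>) * (- (\<i> * R) * (cis (?p L) - 1) +
      (L - R * ?p L) *\<^sub>R cis (R * \<psi> / R)))) {0..L}"
      using has_integral_const_real[of "1::real" 0 L] L
      by (intro has_integral_diff has_integral_cos_diff integral_arc_line_arc R m) auto
    moreover have "1 * (L - 0) - Re (cis (- \<psi>) * (- (\<i> * R) * (cis (?p L) - 1) +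
      (L - R * ?p L) *\<^sub>R cis (R * \<psi> / R))) = ?c"
    proof -
      have E: "cis (- \<psi>) * (- (\<i> * R) * (cis \<Omega> - 1) + (L - R * \<Omega>) *\<^sub>R cis \<psi>)
          = - (\<i> * R) * (cis (\<Omega> - \<psi>) - cis (- \<psi>)) + (L - R * \<Omega>) *\<^sub>R 1"
      proof -
        have e: "cis (- \<psi>) * cis \<Omega> = cis (\<Omega> - \<psi>)" "cis (- \<psi>) * cis \<psi> = 1"
          by (simp_all add: cis_mult)
        have "cis (- \<psi>) * (- (\<i> * R) * (cis \<Omega> - 1) + (L - R * \<Omega>) *\<^sub>R cis \<psi>)
            = - (\<i> * R) * (cis (- \<psi>) * cis \<Omega> - cis (- \<psi>)) + (L - R * \<Omega>) *\<^sub>R (cis (- \<psi>) * cis \<psi>)"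
          by (simp add: algebra_simps)
        then show ?thesis unfolding e .
      qed
      have d: "R * \<psi> / R = \<psi>" using R by simp
      show ?thesis unfolding pL d E by (simp add: algebra_simps)
    qed
    ultimately have hp: "((\<lambda>s. 1 - cos (?p s - \<psi>)) has_integral ?c) {0..L}" by simp
    have h\<phi>: "((\<lambda>s. 1 - cos (\<phi> s - \<psi>)) has_integral ?cost) {0..L}"
      by (intro integrable_integral integrable_continuous_real continuous_intros cont)
    have "?c \<le> ?cost" using hp h\<phi> pointwise by (rule has_integral_le)
    moreover have "\<phi> s = ?p s" if eq: "?cost = ?c" and s: "s \<in> {0..L}" for s
    proof -
      have "((\<lambda>s. (1 - cos (\<phi> s - \<psi>)) - (1 - cos (?p s - \<psi>))) has_integral 0) (cbox 0 L)"
        using has_integral_diff[OF h\<phi> hp] eq by simp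
      then have "(1 - cos (\<phi> s - \<psi>)) - (1 - cos (?p s - \<psi>)) = 0"
        using pointwise L s
        by (intro has_integral_0_cbox_imp_0[of 0 L "\<lambda>s. (1 - cos (\<phi> s - \<psi>)) - (1 - cos (?p s - \<psi>))"]
             continuous_intros) (auto intro: cont continuous_on_arc_line_arc)
      then have "cos \<bar>\<phi> s - \<psi>\<bar> = cos \<bar>?p s - \<psi>\<bar>" by simp
      moreover have "\<bar>?p s - \<psi>\<bar> \<le> \<bar>\<phi> s - \<psi>\<bar>" using parts[OF s] by auto
      ultimately have "\<bar>\<phi> s - \<psi>\<bar> = \<bar>?p s - \<psi>\<bar>"
        using range[OF s] cos_monotone_0_pi[of "\<bar>?p s - \<psi>\<bar>" "\<bar>\<phi> s - \<psi>\<bar>"] by linarith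
      then show ?thesis using parts[OF s] by auto
    qed
    ultimately show ?thesis by blast
  qed
  then show "?c \<le> ?cost" and "?cost = ?c \<Longrightarrow> s \<in> {0..L} \<Longrightarrow> \<phi> s = ?p s"
    by auto
qed

section \<open>Transversal displacement\<close>

lemma integral_reflect_Icc:
  fixes f :: "real \<Rightarrow> real"
  assumes "(f has_integral i) {0..L}" "0 \<le> L"
  shows "((\<lambda>s. f (L - s)) has_integral i) {0..L}"
proof -
  have "(\<lambda>x. L - x) ` {0..L} = {0..L}"
  proof (intro equalityI subsetI)
    fix x assume "x \<in> {0..L}"
    then show "x \<in> (\<lambda>x. L - x) ` {0..L}" by (intro image_eqI[of _ _ "L - x"]) auto
  qed auto
  moreover have "((\<lambda>s. f (L - s)) has_integral i) ((\<lambda>x. L - x) ` {0..L})"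
    using has_integral_affinity[of f i 0 L "-1" L] assms(1) by (simp add: algebra_simps)
  ultimately show ?thesis by simp
qed

text \<open>Turning from \<open>0\<close> to \<open>\<Omega>\<close> with curvature at most \<open>1/R\<close> inside \<open>[0, \<Omega>]\<close> gives at least the
  transversal displacement of an arc of radius \<open>R\<close>.\<close>

lemma sin_integral_lower_bound:
  fixes \<phi> :: "real \<Rightarrow> real"
  assumes R: "0 < R" and L: "0 < L" and cont: "continuous_on {0..L} \<phi>"
    and lip: "\<And>s t. s \<in> {0..L} \<Longrightarrow> t \<in> {0..L} \<Longrightarrow> \<bar>\<phi> t - \<phi> s\<bar> \<le> \<bar>t - s\<bar> / R"
    and start: "\<phi> 0 = 0" and final: "\<phi> L = \<Omega>"
    and range: "\<And>s. s \<in> {0..L} \<Longrightarrow> \<phi> s \<in> {0..\<Omega>}" and \<Omega>: "0 < \<Omega>" "\<Omega> < pi"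
  shows "R * (1 - cos \<Omega>) \<le> integral {0..L} (\<lambda>s. sin (\<phi> s))"
proof -
  \<comment> \<open>\<open>c\<close> is the time at which an arc of radius \<open>R\<close> would have angle \<open>\<pi>/2\<close>; for \<open>\<Omega> \<le> \<pi>/2\<close> the
    comparison arc is aligned with the end of the curve instead, and \<open>c\<close> may exceed \<open>L\<close>\<close>
  have "\<exists>c. 0 \<le> c - R * (pi / 2) \<and> c + R * (\<Omega> - pi / 2) \<le> L \<and>
      (\<forall>s\<in>{c - R * (pi / 2)..c + R * (\<Omega> - pi / 2)}. cos ((s - c) / R) \<le> sin (\<phi> s))"
  proof (cases "\<Omega> \<le> pi / 2")
    case True
    define c where "c = L - R * (\<Omega> - pi / 2)"
    have u: "c - R * (pi / 2) = L - R * \<Omega>" by (simp add: c_def algebra_simps)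
    have "\<Omega> \<le> L / R" using lip[of 0 L] L start final \<Omega> by auto
    then have L_ge: "R * \<Omega> \<le> L" using R by (simp add: field_simps)
    have "cos ((s - c) / R) \<le> sin (\<phi> s)" if s: "s \<in> {L - R * \<Omega>..L}" for s
    proof -
      have sL: "s \<in> {0..L}" using s L_ge by auto
      have "(s - c) / R = (\<Omega> - (L - s) / R) - pi / 2"
        using R by (simp add: c_def field_simps)
      then have "cos ((s - c) / R) = sin (\<Omega> - (L - s) / R)"
        by (simp add: cos_diff)
      moreover have "\<Omega> - (L - s) / R \<le> \<phi> s" using lip[of s L] sL L final by simp
      moreover have "0 \<le> \<Omega> - (L - s) / R" using s R by (simp add: field_simps)
      ultimately show ?thesis
        using range[OF sL] True by (auto intro!: sin_monotone_2pi_le)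
    qed
    then show ?thesis using L_ge u by (intro exI[of _ c]) (auto simp: c_def)
  next
    case False
    obtain c where c: "0 \<le> c" "c \<le> L" "\<phi> c = pi / 2"
      using IVT'[of \<phi> 0 "pi / 2" L] start final False L cont by auto
    have "pi / 2 \<le> c / R" using lip[of 0 c] c start L by simp
    then have u: "0 \<le> c - R * (pi / 2)" using R by (simp add: field_simps)
    have "\<Omega> - pi / 2 \<le> (L - c) / R" using lip[of c L] c final L False by simp
    then have v: "c + R * (\<Omega> - pi / 2) \<le> L" using R by (simp add: field_simps)
    have "cos ((s - c) / R) \<le> sin (\<phi> s)" if s: "s \<in> {c - R * (pi / 2)..c + R * (\<Omega> - pi / 2)}" for s
    proof -
      have "R * (\<Omega> - pi / 2) \<le> R * (pi / 2)" using R \<Omega> by (intro mult_left_mono) auto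
      moreover have "0 \<le> R * (pi / 2)" using R by simp
      moreover have "s - c \<le> R * (\<Omega> - pi / 2)" "c - s \<le> R * (pi / 2)" using s by auto
      ultimately have "\<bar>s - c\<bar> \<le> R * pi" by (simp add: abs_le_iff)
      then have "\<bar>(s - c) / R\<bar> \<le> pi" using R by (simp add: field_simps)
      moreover have "\<bar>\<phi> s - pi / 2\<bar> \<le> \<bar>(s - c) / R\<bar>" using lip[of c s] s u v c R by simp
      ultimately have "cos ((s - c) / R) \<le> cos (\<phi> s - pi / 2)"
        by (intro cos_le_cos_abs)
      then show ?thesis by (simp add: cos_diff)
    qed
    then show ?thesis using u v by blast
  qed
  then obtain c where c: "0 \<le> c - R * (pi / 2)" "c + R * (\<Omega> - pi / 2) \<le> L"
    and pointwise: "\<And>s. s \<in> {c - R * (pi / 2)..c + R * (\<Omega> - pi / 2)} \<Longrightarrow> cos ((s - c) / R) \<le> sin (\<phi> s)"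
    by blast
  let ?u = "c - R * (pi / 2)" and ?v = "c + R * (\<Omega> - pi / 2)"
  have uv: "?u \<le> ?v" using R \<Omega> by (simp add: algebra_simps)
  have "((\<lambda>s. cos ((s - c) / R)) has_integral R * (sin ((?v - c) / R) - sin ((?u - c) / R))) {?u..?v}"
    by (rule has_integral_cos_scaled[OF R uv])
  moreover have "sin ((?v - c) / R) = - cos \<Omega>" "sin ((?u - c) / R) = - 1"
    using R by (simp_all add: sin_diff)
  ultimately have hc: "((\<lambda>s. cos ((s - c) / R)) has_integral R * (1 - cos \<Omega>)) {?u..?v}"
    by (simp add: add.commute)
  have i: "(\<lambda>s. sin (\<phi> s)) integrable_on {?u..?v}" "(\<lambda>s. sin (\<phi> s)) integrable_on {0..L}"
    using c uv by (intro integrable_continuous_real continuous_intros continuous_on_subset[OF cont]; auto)+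
  have "R * (1 - cos \<Omega>) \<le> integral {?u..?v} (\<lambda>s. sin (\<phi> s))"
    using hc pointwise i(1) by (intro has_integral_le[OF hc integrable_integral]) auto
  also have "\<dots> \<le> integral {0..L} (\<lambda>s. sin (\<phi> s))"
    using c \<Omega> range i by (intro integral_subset_le) (auto intro!: sin_ge_zero dest: range)
  finally show ?thesis .
qed

section \<open>Curves and their tangent angles\<close>

lemma tangent_frame:
  assumes "P \<noteq> A" and "P \<noteq> B"
  shows norm_alpha: "norm (alpha P A) = 1"
    and beta_eq: "beta P B = alpha P A * cis (Omega P A B)"
    and chord_eq: "B - A = alpha P A * (dist P A + dist P B * cis (Omega P A B))"
proof -
  show na: "norm (alpha P A) = 1"
    using assms by (simp add: alpha_def dist_norm)
  have nb: "norm (beta P B) = 1"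
    using assms by (simp add: beta_def dist_norm norm_minus_commute)
  then have "norm (beta P B / alpha P A) = 1" using na by (simp add: norm_divide)
  then have "cis (Omega P A B) = beta P B / alpha P A"
    unfolding Omega_def by (subst cis_Arg) (auto simp: sgn_div_norm)
  then show b: "beta P B = alpha P A * cis (Omega P A B)"
    using na by auto
  have "dist P A *\<^sub>R alpha P A = P - A" "dist P B *\<^sub>R beta P B = B - P"
    using assms by (auto simp: alpha_def beta_def)
  then have "B - A = dist P A *\<^sub>R alpha P A + dist P B *\<^sub>R beta P B" by simp
  then show "B - A = alpha P A * (dist P A + dist P B * cis (Omega P A B))"
    by (simp add: b scaleR_conv_of_real algebra_simps)
qed

lemma joining_has_tangent:
  assumes "(L, X) \<in> joining_curves P A B" "s \<in> {0..L}"
  shows "(X has_vector_derivative tangent L X s) (at s within {0..L})"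
  using assms by (simp add: joining_curves_def tangent_def vector_derivative_works)

lemma joining_displacement:
  assumes X: "(L, X) \<in> joining_curves P A B" and norm: "norm a = 1"
    and \<phi>: "\<And>s. s \<in> {0..L} \<Longrightarrow> tangent L X s = a * cis (\<phi> s)" and s: "s \<in> {0..L}"
  shows "((\<lambda>t. cis (\<phi> t)) has_integral (X s - A) / a) {0..s}"
proof -
  have "a \<noteq> 0" using norm by auto
  have "(tangent L X has_integral (X s - X 0)) {0..s}"
    using s by (intro fundamental_theorem_of_calculus has_vector_derivative_within_subset[OF joining_has_tangent[OF X]]) auto
  then have "((\<lambda>t. inverse a * tangent L X t) has_integral inverse a * (X s - X 0)) {0..s}"
    by (rule has_integral_mult_right)
  then have "((\<lambda>t. cis (\<phi> t)) has_integral inverse a * (X s - X 0)) {0..s}"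
    by (rule has_integral_eq[rotated]) (use \<phi> s \<open>a \<noteq> 0\<close> in \<open>auto simp: mult.assoc[symmetric]\<close>)
  moreover have "X 0 = A" using X by (simp add: joining_curves_def)
  ultimately show ?thesis by (simp add: divide_inverse mult.commute)
qed

lemma admissible_angle_lipschitz:
  assumes X: "(L, X) \<in> dubins_admissible P A B R" and R: "0 < R" and norm: "norm a = 1"
    and cont: "continuous_on {0..L} \<phi>"
    and \<phi>: "\<And>s. s \<in> {0..L} \<Longrightarrow> tangent L X s = a * cis (\<phi> s)"
    and s: "s \<in> {0..L}" and t: "t \<in> {0..L}"
  shows "\<bar>\<phi> t - \<phi> s\<bar> \<le> \<bar>t - s\<bar> / R"
proof -
  have T: "continuous_on {0..L} (tangent L X)"
    using X by (simp add: dubins_admissible_def joining_curves_def)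
  obtain W where W: "W \<in> L_inf L" "weak_derivative L (tangent L X) W"
    "AE s in lebesgue. s \<in> {0<..<L} \<longrightarrow> norm (W s) \<le> 1 / R"
    using X by (auto simp: dubins_admissible_def)
  have "norm (cis (\<phi> v) - cis (\<phi> u)) \<le> 1 / R * (v - u)"
    if "u \<in> {0..L}" "v \<in> {0..L}" "u \<le> v" for u v
  proof -
    have "norm (tangent L X v - tangent L X u) \<le> 1 / R * (v - u)"
      using weak_derivative_lipschitz[OF T W(2,1,3)] R that by simp
    moreover have "tangent L X v - tangent L X u = a * (cis (\<phi> v) - cis (\<phi> u))"
      using \<phi> that by (simp add: algebra_simps)
    ultimately show ?thesis using norm by (simp add: norm_mult)
  qed
  then show ?thesis
    using angle_lipschitz[OF cont, of "1 / R" s t] R s t by simp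
qed

text \<open>The curve with initial point \<open>A\<close>, initial direction \<open>a\<close> and length \<open>L\<close> made of an arc of length
  \<open>m1\<close>, a segment of length \<open>m2 - m1\<close>, and an arc; both arcs turn left with radius \<open>R\<close>.\<close>

definition arc_line_arc_curve :: "complex \<Rightarrow> complex \<Rightarrow> real \<Rightarrow> real \<Rightarrow> real \<Rightarrow> real \<Rightarrow> curve" where
  "arc_line_arc_curve A a R m1 m2 L =
     (L, \<lambda>s\<in>{0..L}. A + a * integral {0..s} (\<lambda>t. cis (arc_line_arc R m1 m2 t)))"

lemma joining_eq_arc_line_arc_curve:
  assumes X: "(L, X) \<in> joining_curves P A B" and norm: "norm a = 1"
    and \<phi>: "\<And>s. s \<in> {0..L} \<Longrightarrow> tangent L X s = a * cis (\<phi> s)"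
    and eq: "\<And>s. s \<in> {0..L} \<Longrightarrow> \<phi> s = arc_line_arc R m1 m2 s"
  shows "(L, X) = arc_line_arc_curve A a R m1 m2 L"
proof -
  have "X s = A + a * integral {0..s} (\<lambda>t. cis (arc_line_arc R m1 m2 t))" if s: "s \<in> {0..L}" for s
  proof -
    have "((\<lambda>t. cis (arc_line_arc R m1 m2 t)) has_integral (X s - A) / a) {0..s}"
      by (rule joining_displacement[OF X norm _ s]) (simp add: \<phi> eq)
    then show ?thesis using norm by (auto simp: integral_unique)
  qed
  moreover have "X \<in> extensional {0..L}" using X by (simp add: joining_curves_def)
  ultimately show ?thesis
    by (auto simp: arc_line_arc_curve_def extensional_def restrict_def fun_eq_iff)
qed

lemma arc_line_arc_curve_tangent:
  assumes L: "0 < L" and s: "s \<in> {0..L}" and X_def: "X = snd (arc_line_arc_curve A a R m1 m2 L)"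
  shows "(X has_vector_derivative a * cis (arc_line_arc R m1 m2 s)) (at s within {0..L})"
    and "tangent L X s = a * cis (arc_line_arc R m1 m2 s)"
proof -
  have "continuous_on {0..L} (\<lambda>t. cis (arc_line_arc R m1 m2 t))"
    unfolding cis_conv_exp by (intro continuous_intros continuous_on_arc_line_arc)
  then have "((\<lambda>s. integral {0..s} (\<lambda>t. cis (arc_line_arc R m1 m2 t))) has_vector_derivative
      cis (arc_line_arc R m1 m2 s)) (at s within {0..L})"
    using s by (rule integral_has_vector_derivative)
  then have "((\<lambda>s. A + a * integral {0..s} (\<lambda>t. cis (arc_line_arc R m1 m2 t))) has_vector_derivative
      0 + a * cis (arc_line_arc R m1 m2 s)) (at s within {0..L})"
    by (intro has_vector_derivative_add has_vector_derivative_const has_vector_derivative_mult_right)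
  then show d: "(X has_vector_derivative a * cis (arc_line_arc R m1 m2 s)) (at s within {0..L})"
    unfolding add_0_left by (rule has_vector_derivative_transform[rotated 2])
      (use s in \<open>auto simp: X_def arc_line_arc_curve_def\<close>)
  then show "tangent L X s = a * cis (arc_line_arc R m1 m2 s)"
    unfolding tangent_def using vector_derivative_within_closed_interval[OF L s] by blast
qed

lemma arc_line_arc_curve_admissible:
  assumes PA: "P \<noteq> A" and PB: "P \<noteq> B" and R: "0 < R" and L: "0 < L"
    and m: "0 \<le> m1" "m1 \<le> m2" "m2 \<le> L"
    and turn: "m1 + (L - m2) = R * Omega P A B"
    and closing: "dist P A + dist P B * cis (Omega P A B) =
      - (\<i> * R) * (cis (Omega P A B) - 1) + (m2 - m1) *\<^sub>R cis (m1 / R)"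
  shows "arc_line_arc_curve A (alpha P A) R m1 m2 L \<in> dubins_admissible P A B R"
    and "arc_line_arc_curve A (alpha P A) R m1 m2 L \<in> curves_E P A B"
proof -
  let ?\<Omega> = "Omega P A B" and ?p = "arc_line_arc R m1 m2"
  define a where "a = alpha P A"
  define X where "X = snd (arc_line_arc_curve A a R m1 m2 L)"
  have LX: "arc_line_arc_curve A (alpha P A) R m1 m2 L = (L, X)"
    by (simp add: X_def a_def arc_line_arc_curve_def)
  have na: "norm a = 1" using norm_alpha[OF PA PB] by (simp add: a_def)
  note d = arc_line_arc_curve_tangent[OF L _ X_def]
  let ?T = "\<lambda>s. a * cis (?p s)"
  let ?W = "\<lambda>s. arc_line_arc_slope R m1 m2 s *\<^sub>R (a * (\<i> * cis (?p s)))"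
  have p0: "?p 0 = 0" using m by (simp add: arc_line_arc_def)
  have "min L m1 = m1" "max 0 (L - m2) = L - m2" using m by auto
  then have pL: "?p L = ?\<Omega>" using R turn by (simp add: arc_line_arc_def)
  have cT: "continuous_on S ?T" for S
    unfolding cis_conv_exp by (intro continuous_intros continuous_on_arc_line_arc)
  have cT': "continuous_on {0..L} (tangent L X)"
    using cT[of "{0..L}"] by (rule continuous_on_eq) (simp add: d(2))
  have cX: "continuous_on {0..L} X"
    using d(1) by (meson continuous_on_eq_continuous_within has_vector_derivative_continuous)
  have at: "at s within {0..L} = at s" if "s \<in> {0<..<L}" for s
    using that by (intro at_within_interior) auto
  have DX: "(X has_vector_derivative ?T s) (at s)" if "s \<in> {0<..<L}" for s
    using d(1)[of s] that at[OF that] by auto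
  have DT: "(?T has_vector_derivative ?W s) (at s)" if "s \<in> {0<..<L} - {m1, m2}" for s
  proof -
    have "((\<lambda>s. cis (?p s)) has_vector_derivative
        arc_line_arc_slope R m1 m2 s *\<^sub>R (\<i> * cis (?p s))) (at s)"
      using that m by (intro has_vector_derivative_cis arc_line_arc_has_derivative) auto
    then have "(?T has_vector_derivative a * arc_line_arc_slope R m1 m2 s *\<^sub>R (\<i> * cis (?p s))) (at s)"
      by (rule has_vector_derivative_mult_right)
    then show ?thesis by simp
  qed
  have DT': "(tangent L X has_vector_derivative ?W s) (at s)" if s: "s \<in> {0<..<L} - {m1, m2}" for s
    using DT[OF s]
    by (rule has_vector_derivative_transform_within_open[of _ _ _ "{0<..<L}"]) (use s in \<open>auto simp: d(2)\<close>)
  have W_bound: "norm (?W s) \<le> 1 / R" for s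
    using R na by (auto simp: arc_line_arc_slope_def norm_mult)
  have W: "?W \<in> L_inf L"
  proof -
    have "(\<lambda>s. arc_line_arc_slope R m1 m2 s) \<in> borel_measurable borel"
      unfolding arc_line_arc_slope_def by measurable
    moreover have "(\<lambda>s. a * (\<i> * cis (?p s))) \<in> borel_measurable borel"
      unfolding cis_conv_exp
      by (intro borel_measurable_continuous_onI continuous_intros continuous_on_arc_line_arc)
    ultimately have "(\<lambda>s. indicator {0<..<L} s *\<^sub>R ?W s) \<in> borel_measurable borel"
      by (intro borel_measurable_scaleR) auto
    then have "(\<lambda>s. indicator {0<..<L} s *\<^sub>R ?W s) \<in> borel_measurable lebesgue"
      by (intro measurable_completion) auto
    moreover have "AE s in lebesgue. s \<in> {0<..<L} \<longrightarrow> norm (?W s) \<le> 1 / R"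
      by (intro AE_I2 impI W_bound)
    ultimately show ?thesis
      unfolding L_inf_def set_borel_measurable_def by (intro CollectI conjI exI)
  qed
  have wT: "weak_derivative L ?T ?W"
    by (rule weak_derivative_of_derivative[where S = "{m1, m2}", OF cT W _ DT L]) auto
  have wT': "weak_derivative L (tangent L X) ?W"
    by (rule weak_derivative_of_derivative[where S = "{m1, m2}", OF cT' W _ DT' L]) auto
  have wX: "weak_derivative L X ?T"
    by (rule weak_derivative_of_derivative[OF cX continuous_in_L_inf[OF cT] finite.emptyI _ L])
      (use DX in auto)
  have T_W1: "?T \<in> W1_inf L"
    unfolding W1_inf_def by (intro CollectI conjI bexI[where x = ?W] wT W continuous_in_L_inf cT)
  have X_W2: "X \<in> W2_inf L"
    unfolding W2_inf_def by (intro CollectI conjI bexI[where x = ?T] wX T_W1 continuous_in_L_inf cX)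
  have X_ext: "X s = A + a * integral {0..s} (\<lambda>t. cis (?p t))" if "s \<in> {0..L}" for s
    using that by (simp add: X_def arc_line_arc_curve_def)
  have "integral {0..L} (\<lambda>t. cis (?p t)) = dist P A + dist P B * cis ?\<Omega>"
  proof -
    have "L - R * ?\<Omega> = m2 - m1" using turn by simp
    then show ?thesis
      using integral_unique[OF integral_arc_line_arc[OF R m(1,2), of L]] L pL closing by simp
  qed
  then have "X L - A = B - A"
    unfolding chord_eq[OF PA PB] using X_ext[of L] L by (simp add: a_def)
  then have XL: "X L = B" by simp
  have join: "(L, X) \<in> joining_curves P A B"
    unfolding joining_curves_def
  proof (clarsimp, intro conjI ballI)
    show "X \<in> extensional {0..L}" by (simp add: X_def arc_line_arc_curve_def)
    show "X differentiable at s within {0..L}" if "s \<in> {0..L}" for s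
      using d(1)[OF that] by (rule differentiableI_vector)
    show "norm (tangent L X s) = 1" if "s \<in> {0..L}" for s
      using that na by (simp add: d(2) norm_mult)
    show "X 0 = A" using X_ext[of 0] L by simp
    show "tangent L X 0 = alpha P A" using L by (simp add: d(2) p0 a_def)
    show "tangent L X L = beta P B" using L beta_eq[OF PA PB] by (simp add: d(2) pL a_def)
  qed (use L X_W2 cT' XL in auto)
  show "arc_line_arc_curve A (alpha P A) R m1 m2 L \<in> dubins_admissible P A B R"
    unfolding LX dubins_admissible_def
    by (intro CollectI case_prodI conjI join bexI[of _ ?W] wT' W AE_I2 impI W_bound)
  have "tangent L X s = cos (?p s) *\<^sub>R alpha P A + sin (?p s) *\<^sub>R (\<i> * alpha P A)" if "s \<in> {0..L}" for s
    unfolding d(2)[OF that] by (simp add: a_def complex_eq_iff algebra_simps)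
  then show "arc_line_arc_curve A (alpha P A) R m1 m2 L \<in> curves_E P A B"
    unfolding LX curves_E_def
    using join p0 pL continuous_on_arc_line_arc[of "{0..L}" R m1 m2] arc_line_arc_mono[OF R, of _ _ m1 m2]
    by (auto simp: mono_on_def intro!: exI[of _ ?p])
qed

section \<open>Geodesics\<close>

lemma minus_i_cis_minus_one:
  assumes "0 < \<Omega>" "\<Omega> < pi"
  shows "- \<i> * (cis \<Omega> - 1) = complex_of_real (tan (\<Omega> / 2)) * (1 + cis \<Omega>)"
    and "1 - cos \<Omega> = tan (\<Omega> / 2) * sin \<Omega>"
    and "0 < tan (\<Omega> / 2)"
proof -
  have s: "0 < sin \<Omega>" using assms by (rule sin_gt_zero)
  have c: "0 < 1 + cos \<Omega>" using cos_gt_minus_one[of \<Omega>] assms by simp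
  have t: "tan (\<Omega> / 2) = sin \<Omega> / (cos \<Omega> + 1)" using tan_half[of "\<Omega> / 2"] by simp
  have t1: "tan (\<Omega> / 2) * (1 + cos \<Omega>) = sin \<Omega>" using c by (simp add: t add.commute)
  have "(1 - cos \<Omega>) * (1 + cos \<Omega>) = sin \<Omega> * sin \<Omega>"
    using sin_cos_squared_add[of \<Omega>] by (simp add: algebra_simps power2_eq_square)
  then show t2: "1 - cos \<Omega> = tan (\<Omega> / 2) * sin \<Omega>" using c by (simp add: t field_simps)
  show "0 < tan (\<Omega> / 2)" using s c by (simp add: t)
  show "- \<i> * (cis \<Omega> - 1) = complex_of_real (tan (\<Omega> / 2)) * (1 + cis \<Omega>)"
    using t1 t2 by (simp add: complex_eq_iff)
qed

lemma arc_displacement: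
  fixes R \<Omega> :: real
  assumes "0 < \<Omega>" "\<Omega> < pi"
  shows "- (\<i> * R) * (cis \<Omega> - 1) =
    complex_of_real (R * tan (\<Omega> / 2)) + complex_of_real (R * tan (\<Omega> / 2)) * cis \<Omega>"
proof -
  have "- (\<i> * R) * (cis \<Omega> - 1) = R * (- \<i> * (cis \<Omega> - 1))" by simp
  also have "\<dots> = R * (complex_of_real (tan (\<Omega> / 2)) * (1 + cis \<Omega>))"
    unfolding minus_i_cis_minus_one(1)[OF assms] ..
  also have "\<dots> = complex_of_real (R * tan (\<Omega> / 2)) + complex_of_real (R * tan (\<Omega> / 2)) * cis \<Omega>"
    by (simp add: ring_distribs mult.assoc)
  finally show ?thesis .
qed

lemma curves_E_angle:
  assumes "(L, X) \<in> curves_E P A B"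
  obtains \<phi> where "continuous_on {0..L} \<phi>" "\<phi> 0 = 0" "\<phi> L = Omega P A B" "mono_on {0..L} \<phi>"
    "\<And>s. s \<in> {0..L} \<Longrightarrow> tangent L X s = alpha P A * cis (\<phi> s)"
proof -
  obtain \<phi> where \<phi>: "continuous_on {0..L} \<phi>" "\<phi> 0 = 0" "\<phi> L = Omega P A B" "mono_on {0..L} \<phi>"
    "\<forall>s\<in>{0..L}. tangent L X s = cos (\<phi> s) *\<^sub>R alpha P A + sin (\<phi> s) *\<^sub>R (\<i> * alpha P A)"
    using assms by (auto simp: curves_E_def)
  have "tangent L X s = alpha P A * cis (\<phi> s)" if "s \<in> {0..L}" for s
    using \<phi>(5) that by (simp add: complex_eq_iff algebra_simps)
  then show ?thesis using that \<phi> by blast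
qed

lemma curves_E_radius_bound:
  assumes PA: "P \<noteq> A" and PB: "P \<noteq> B" and \<Omega>: "0 < Omega P A B" "Omega P A B < pi"
    and R: "0 < R" and E: "G \<in> curves_E P A B" and adm: "G \<in> dubins_admissible P A B R"
  shows "R * tan (Omega P A B / 2) \<le> min (dist P A) (dist P B)"
proof -
  let ?\<Omega> = "Omega P A B"
  obtain L X where G: "G = (L, X)" by (cases G)
  have X: "(L, X) \<in> joining_curves P A B" and L: "0 < L"
    using E G by (auto simp: curves_E_def joining_curves_def)
  note na = norm_alpha[OF PA PB]
  obtain \<phi> where \<phi>: "continuous_on {0..L} \<phi>" "\<phi> 0 = 0" "\<phi> L = ?\<Omega>" "mono_on {0..L} \<phi>"
    "\<And>s. s \<in> {0..L} \<Longrightarrow> tangent L X s = alpha P A * cis (\<phi> s)"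
    using curves_E_angle E G by metis
  have lip: "\<bar>\<phi> t - \<phi> s\<bar> \<le> \<bar>t - s\<bar> / R" if "s \<in> {0..L}" "t \<in> {0..L}" for s t
    using adm unfolding G by (rule admissible_angle_lipschitz[OF _ R na \<phi>(1) \<phi>(5) that])
  have range: "\<phi> s \<in> {0..?\<Omega>}" if "s \<in> {0..L}" for s
    using mono_onD[OF \<phi>(4), of 0 s] mono_onD[OF \<phi>(4), of s L] that \<phi>(2,3) by auto
  have XL: "X L = B" using X by (simp add: joining_curves_def)
  have "(X L - A) / alpha P A = dist P A + dist P B * cis ?\<Omega>"
    unfolding XL chord_eq[OF PA PB] using na by auto
  then have int: "((\<lambda>t. cis (\<phi> t)) has_integral (dist P A + dist P B * cis ?\<Omega>)) {0..L}"
    using joining_displacement[OF X na \<phi>(5), of L] L by simp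
  have b: "((\<lambda>t. sin (\<phi> t)) has_integral dist P B * sin ?\<Omega>) {0..L}"
    using has_integral_cos_diff[OF int, of "pi / 2"] by (simp add: cos_diff cis_mult)
  have "((\<lambda>t. cos (\<phi> t - (?\<Omega> - pi / 2))) has_integral
      Re (cis (- (?\<Omega> - pi / 2)) * (dist P A + dist P B * cis ?\<Omega>))) {0..L}"
    by (rule has_integral_cos_diff[OF int])
  moreover have "Re (cis (- (?\<Omega> - pi / 2)) * (dist P A + dist P B * cis ?\<Omega>)) = dist P A * sin ?\<Omega>"
    by (simp add: cos_diff sin_diff algebra_simps)
  moreover have "cos (\<phi> t - (?\<Omega> - pi / 2)) = sin (?\<Omega> - \<phi> t)" for t
    unfolding sin_cos_eq by (rule arg_cong[where f = cos]) simp
  ultimately have a: "((\<lambda>t. sin (?\<Omega> - \<phi> t)) has_integral dist P A * sin ?\<Omega>) {0..L}"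
    by simp
  have "R * (1 - cos ?\<Omega>) \<le> integral {0..L} (\<lambda>s. sin (\<phi> s))"
    by (rule sin_integral_lower_bound[OF R L \<phi>(1) lip \<phi>(2,3) range \<Omega>])
  then have B: "R * (1 - cos ?\<Omega>) \<le> dist P B * sin ?\<Omega>" using b by (simp add: integral_unique)
  \<comment> \<open>the angle of the reversed curve\<close>
  let ?\<theta> = "\<lambda>s. ?\<Omega> - \<phi> (L - s)"
  have "R * (1 - cos ?\<Omega>) \<le> integral {0..L} (\<lambda>s. sin (?\<theta> s))"
  proof (rule sin_integral_lower_bound[OF R L _ _ _ _ _ \<Omega>])
    show "continuous_on {0..L} ?\<theta>"
      by (intro continuous_intros continuous_on_compose2[OF \<phi>(1)]) auto
    show "\<bar>?\<theta> t - ?\<theta> s\<bar> \<le> \<bar>t - s\<bar> / R" if "s \<in> {0..L}" "t \<in> {0..L}" for s t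
      using lip[of "L - t" "L - s"] that by simp
    show "?\<theta> s \<in> {0..?\<Omega>}" if "s \<in> {0..L}" for s using range[of "L - s"] that by simp
  qed (use \<phi> in auto)
  then have A: "R * (1 - cos ?\<Omega>) \<le> dist P A * sin ?\<Omega>"
    using integral_reflect_Icc[OF a] L by (simp add: integral_unique)
  have "0 < sin ?\<Omega>" using \<Omega> by (rule sin_gt_zero)
  then show ?thesis
    using A B minus_i_cis_minus_one(2)[OF \<Omega>] by (simp add: mult.assoc[symmetric])
qed

text \<open>The closing equation says that the arc-line-arc curve with arcs of radius \<open>R\<close> and a segment of
  length \<open>g\<close> and direction \<open>\<psi>\<close> (relative to the initial tangent) ends at \<open>B\<close>.\<close>

lemma admissible_length_bound:
  assumes PA: "P \<noteq> A" and PB: "P \<noteq> B" and \<Omega>: "Omega P A B < pi" and R: "0 < R"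
    and \<psi>: "0 \<le> \<psi>" "\<psi> \<le> Omega P A B"
    and closing: "dist P A + dist P B * cis (Omega P A B) =
      - (\<i> * R) * (cis (Omega P A B) - 1) + g *\<^sub>R cis \<psi>"
    and adm: "G \<in> dubins_admissible P A B R"
  shows "R * Omega P A B + g \<le> fst G"
    and "fst G = R * Omega P A B + g \<Longrightarrow> G =
      arc_line_arc_curve A (alpha P A) R (R * \<psi>) (R * \<psi> + g) (R * Omega P A B + g)"
proof -
  let ?\<Omega> = "Omega P A B"
  obtain L X where G: "G = (L, X)" by (cases G)
  have X: "(L, X) \<in> joining_curves P A B" and L: "0 < L"
    using adm G by (auto simp: dubins_admissible_def joining_curves_def)
  have cT: "continuous_on {0..L} (tangent L X)" and nT: "\<And>s. s \<in> {0..L} \<Longrightarrow> norm (tangent L X s) = 1"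
    and ends: "X L = B" "tangent L X 0 = alpha P A" "tangent L X L = beta P B"
    using X by (auto simp: joining_curves_def)
  note na = norm_alpha[OF PA PB]
  obtain \<phi> where \<phi>: "continuous_on {0..L} \<phi>" "\<phi> 0 = 0"
    "\<And>s. s \<in> {0..L} \<Longrightarrow> tangent L X s = alpha P A * cis (\<phi> s)"
    using continuous_angle_exists[OF cT _ nT] L ends(2) by (metis less_imp_le)
  have lip: "\<bar>\<phi> t - \<phi> s\<bar> \<le> \<bar>t - s\<bar> / R" if "s \<in> {0..L}" "t \<in> {0..L}" for s t
    using adm unfolding G by (rule admissible_angle_lipschitz[OF _ R na \<phi>(1) \<phi>(3) that])
  have final: "cis (\<phi> L) = cis ?\<Omega>"
    using \<phi>(3)[of L] L ends(3) beta_eq[OF PA PB] na by auto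
  have "(X L - A) / alpha P A = dist P A + dist P B * cis ?\<Omega>"
    unfolding ends(1) chord_eq[OF PA PB] using na by auto
  then have "((\<lambda>t. cis (\<phi> t)) has_integral (- (\<i> * R) * (cis ?\<Omega> - 1) + g *\<^sub>R cis \<psi>)) {0..L}"
    using joining_displacement[OF X na \<phi>(3), of L] L closing by simp
  note h = has_integral_cos_diff[OF this, of \<psi>]
  have "((\<lambda>t. cos (\<phi> t - \<psi>)) has_integral R * (sin \<psi> + sin (?\<Omega> - \<psi>)) + g) {0..L}"
  proof -
    have e: "cis (- \<psi>) * cis ?\<Omega> = cis (?\<Omega> - \<psi>)" "cis (- \<psi>) * cis \<psi> = 1"
      by (simp_all add: cis_mult)
    have E: "cis (- \<psi>) * (- (\<i> * R) * (cis ?\<Omega> - 1) + g *\<^sub>R cis \<psi>)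
        = - (\<i> * R) * (cis (- \<psi>) * cis ?\<Omega> - cis (- \<psi>)) + g *\<^sub>R (cis (- \<psi>) * cis \<psi>)"
      by (simp add: algebra_simps)
    have "Re (cis (- \<psi>) * (- (\<i> * R) * (cis ?\<Omega> - 1) + g *\<^sub>R cis \<psi>)) = R * (sin \<psi> + sin (?\<Omega> - \<psi>)) + g"
      unfolding E e by (simp add: algebra_simps)
    then show ?thesis using h by (simp only:)
  qed
  then have "((\<lambda>t. 1 - cos (\<phi> t - \<psi>)) has_integral 1 * (L - 0) - (R * (sin \<psi> + sin (?\<Omega> - \<psi>)) + g)) {0..L}"
    using has_integral_const_real[of "1::real" 0 L] L by (intro has_integral_diff) auto
  then have cost: "integral {0..L} (\<lambda>t. 1 - cos (\<phi> t - \<psi>)) = L - R * (sin \<psi> + sin (?\<Omega> - \<psi>)) - g"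
    by (simp add: integral_unique)
  note cost_bound = angle_cost[OF R L \<phi>(1) lip \<phi>(2) final \<psi> \<Omega>]
  show "R * ?\<Omega> + g \<le> fst G"
    using cost_bound(1) by (simp add: cost G algebra_simps)
  assume len: "fst G = R * ?\<Omega> + g"
  then have "L = R * ?\<Omega> + g" by (simp add: G)
  then have m2: "L - R * (?\<Omega> - \<psi>) = R * \<psi> + g" by (simp add: algebra_simps)
  have eq: "\<phi> s = arc_line_arc R (R * \<psi>) (R * \<psi> + g) s" if "s \<in> {0..L}" for s
  proof -
    have "integral {0..L} (\<lambda>t. 1 - cos (\<phi> t - \<psi>)) = R * (?\<Omega> - sin \<psi> - sin (?\<Omega> - \<psi>))"
      unfolding cost using len by (simp add: G algebra_simps)
    from cost_bound(2)[OF _ _ this that] show ?thesis unfolding m2 by blast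
  qed
  have "(L, X) = arc_line_arc_curve A (alpha P A) R (R * \<psi>) (R * \<psi> + g) L"
    by (rule joining_eq_arc_line_arc_curve[OF X na \<phi>(3) eq])
  then show "G = arc_line_arc_curve A (alpha P A) R (R * \<psi>) (R * \<psi> + g) (R * ?\<Omega> + g)"
    unfolding G \<open>L = R * ?\<Omega> + g\<close>[symmetric] .
qed

lemma geodesic_iff_arc_line_arc_curve:
  assumes PA: "P \<noteq> A" and PB: "P \<noteq> B" and \<Omega>: "0 < Omega P A B" "Omega P A B < pi" and R: "0 < R"
    and \<psi>: "0 \<le> \<psi>" "\<psi> \<le> Omega P A B" and g: "0 \<le> g"
    and closing: "dist P A + dist P B * cis (Omega P A B) =
      - (\<i> * R) * (cis (Omega P A B) - 1) + g *\<^sub>R cis \<psi>"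
  defines "G0 \<equiv> arc_line_arc_curve A (alpha P A) R (R * \<psi>) (R * \<psi> + g) (R * Omega P A B + g)"
  shows "is_dubins_geodesic P A B R G \<longleftrightarrow> G = G0"
    and "G0 \<in> curves_E P A B"
proof -
  have "R * \<psi> \<le> R * Omega P A B" "0 < R * Omega P A B" "0 \<le> R * \<psi>"
    using R \<psi> \<Omega> by (auto intro: mult_left_mono)
  then have m: "0 < R * Omega P A B + g" "0 \<le> R * \<psi>" "R * \<psi> \<le> R * \<psi> + g" "R * \<psi> + g \<le> R * Omega P A B + g"
    "R * \<psi> + (R * Omega P A B + g - (R * \<psi> + g)) = R * Omega P A B"
    using g by auto
  have c: "dist P A + dist P B * cis (Omega P A B) =
      - (\<i> * R) * (cis (Omega P A B) - 1) + (R * \<psi> + g - R * \<psi>) *\<^sub>R cis (R * \<psi> / R)"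
    using closing R by simp
  note adm = arc_line_arc_curve_admissible[OF PA PB R m c, folded G0_def]
  show "G0 \<in> curves_E P A B" by (rule adm(2))
  have len: "fst G0 = R * Omega P A B + g" by (simp add: G0_def arc_line_arc_curve_def)
  note bound = admissible_length_bound[OF PA PB \<Omega>(2) R \<psi> closing, folded G0_def]
  show "is_dubins_geodesic P A B R G \<longleftrightarrow> G = G0"
  proof
    assume "is_dubins_geodesic P A B R G"
    then have "G \<in> dubins_admissible P A B R" "fst G \<le> fst G0"
      using adm(1) by (auto simp: is_dubins_geodesic_def)
    then show "G = G0" using bound len by (metis order_antisym)
  next
    assume "G = G0"
    then show "is_dubins_geodesic P A B R G"
      using adm(1) bound(1) len by (simp add: is_dubins_geodesic_def)
  qed
qed

text \<open>A vector in the cone spanned by the directions \<open>0\<close> and \<open>\<Omega>\<close> has its direction in \<open>[0, \<Omega>]\<close>.\<close>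

lemma cone_polar_form:
  fixes x y \<Omega> :: real
  assumes "0 \<le> x" "0 \<le> y" and \<Omega>: "0 < \<Omega>" "\<Omega> < pi"
  obtains g \<psi> where "0 \<le> g" "0 \<le> \<psi>" "\<psi> \<le> \<Omega>" "x + y * cis \<Omega> = g *\<^sub>R cis \<psi>"
proof -
  define z where "z = x + y * cis \<Omega>"
  have s: "0 < sin \<Omega>" using \<Omega> by (rule sin_gt_zero)
  show ?thesis
  proof (cases "z = 0")
    case True
    then show ?thesis using that[of 0 0] \<Omega> by (simp add: z_def)
  next
    case False
    define \<psi> where "\<psi> = Arg z"
    have z: "z = norm z *\<^sub>R cis \<psi>"
      using False by (simp add: \<psi>_def cis_Arg sgn_div_norm)
    have \<psi>: "- pi < \<psi>" "\<psi> \<le> pi" by (simp_all add: \<psi>_def Arg_bounded)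
    have "0 \<le> Im z" using s assms by (simp add: z_def)
    then have lo: "0 \<le> \<psi>" by (simp add: \<psi>_def Arg_less_0)
    have "\<psi> \<le> \<Omega>"
    proof (rule ccontr)
      assume "\<not> ?thesis"
      then have "0 < sin (\<psi> - \<Omega>)" using \<psi> \<Omega> by (intro sin_gt_zero) auto
      then have "0 < norm z * sin (\<psi> - \<Omega>)" using False by simp
      also have "norm z * sin (\<psi> - \<Omega>) = Im (norm z *\<^sub>R cis \<psi> * cis (- \<Omega>))"
        by (simp add: cis_mult)
      also have "\<dots> = Im (z * cis (- \<Omega>))" using z by simp
      also have "\<dots> = - x * sin \<Omega>"
        by (simp add: z_def algebra_simps)
      finally show False using s assms mult_nonneg_nonneg[OF assms(1) less_imp_le[OF s]] by simp
    qed
    moreover have "x + y * cis \<Omega> = norm z *\<^sub>R cis \<psi>"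
      unfolding z_def[symmetric] by (rule z)
    ultimately show ?thesis using that[OF norm_ge_zero lo] by blast
  qed
qed

section \<open>The curve \<open>\<J>\<close>\<close>

text \<open>In a curve with nondecreasing angle a circular arc is necessarily travelled to the left.\<close>

lemma circular_arc_angle:
  assumes X: "(L, X) \<in> joining_curves P A B" and norm: "norm a = 1" and r: "0 < r"
    and cont: "continuous_on {0..L} \<phi>" and mono: "mono_on {0..L} \<phi>"
    and \<phi>: "\<And>s. s \<in> {0..L} \<Longrightarrow> tangent L X s = a * cis (\<phi> s)"
    and uv: "0 \<le> u" "u < v" "v \<le> L" and arc: "circular_arc r X u v" and s: "s \<in> {u..v}"
  shows "\<phi> s = \<phi> u + (s - u) / r"
proof -
  obtain c \<theta> \<epsilon> where \<epsilon>: "\<epsilon> \<in> {-1, 1}"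
    and arc: "\<And>s. s \<in> {u..v} \<Longrightarrow> X s = c + r *\<^sub>R cis (\<theta> + \<epsilon> * (s - u) / r)"
    using arc unfolding circular_arc_def by blast
  have tangent: "a * cis (\<phi> s) = \<epsilon> *\<^sub>R (\<i> * cis (\<theta> + \<epsilon> * (s - u) / r))" if s: "s \<in> {u..v}" for s
  proof (rule vector_derivative_unique_within)
    show "at s within {u..v} \<noteq> bot"
      using uv(2) s by (simp add: trivial_limit_within islimpt_Icc)
    have "(X has_vector_derivative tangent L X s) (at s within {0..L})"
      using joining_has_tangent[OF X] s uv by auto
    then show "(X has_vector_derivative a * cis (\<phi> s)) (at s within {u..v})"
      using \<phi>[of s] s uv by (auto intro: has_vector_derivative_within_subset)
    have "((\<lambda>s. \<theta> + \<epsilon> * (s - u) / r) has_real_derivative \<epsilon> / r) (at s within {u..v})"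
      using r by (auto intro!: derivative_eq_intros)
    then have "((\<lambda>s. c + r *\<^sub>R cis (\<theta> + \<epsilon> * (s - u) / r)) has_vector_derivative
        0 + r *\<^sub>R ((\<epsilon> / r) *\<^sub>R (\<i> * cis (\<theta> + \<epsilon> * (s - u) / r)))) (at s within {u..v})"
      by (intro has_vector_derivative_add has_vector_derivative_const
          bounded_linear.has_vector_derivative[OF bounded_linear_scaleR_right] has_vector_derivative_cis)
    then have "((\<lambda>s. c + r *\<^sub>R cis (\<theta> + \<epsilon> * (s - u) / r)) has_vector_derivative
        \<epsilon> *\<^sub>R (\<i> * cis (\<theta> + \<epsilon> * (s - u) / r))) (at s within {u..v})"
      using r by simp
    then show "(X has_vector_derivative \<epsilon> *\<^sub>R (\<i> * cis (\<theta> + \<epsilon> * (s - u) / r))) (at s within {u..v})"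
      by (rule has_vector_derivative_transform[rotated 2]) (use s arc in auto)
  qed
  have "cis (\<phi> s - \<epsilon> * (s - u) / r) = inverse a * \<epsilon> *\<^sub>R (\<i> * cis \<theta>)" if s: "s \<in> {u..v}" for s
  proof -
    have "a \<noteq> 0" using norm by auto
    then have "cis (\<phi> s) = inverse a * (a * cis (\<phi> s))" by simp
    then have c: "cis (\<phi> s) = inverse a * \<epsilon> *\<^sub>R (\<i> * cis (\<theta> + \<epsilon> * (s - u) / r))"
      unfolding tangent[OF s] .
    have "cis (\<phi> s - \<epsilon> * (s - u) / r) = cis (\<phi> s) * cis (- (\<epsilon> * (s - u) / r))"
      by (simp add: cis_mult)
    also have "\<dots> = inverse a * \<epsilon> *\<^sub>R (\<i> * (cis (\<theta> + \<epsilon> * (s - u) / r) * cis (- (\<epsilon> * (s - u) / r))))"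
      unfolding c by (simp add: mult.assoc)
    finally show ?thesis by (simp add: cis_mult)
  qed
  then have const: "\<phi> s - \<epsilon> * (s - u) / r = \<phi> u - \<epsilon> * (u - u) / r" if "s \<in> {u..v}" for s
    using that uv r
    by (intro angle_constant[of u v "\<lambda>s. \<phi> s - \<epsilon> * (s - u) / r"] continuous_intros
        continuous_on_subset[OF cont]) auto
  have "\<epsilon> = 1"
  proof (rule ccontr)
    assume "\<epsilon> \<noteq> 1"
    then have "\<phi> v = \<phi> u - (v - u) / r" using const[of v] \<epsilon> uv r by (auto simp: field_simps)
    moreover have "\<phi> u \<le> \<phi> v" using mono_onD[OF mono, of u v] uv by auto
    moreover have "0 < (v - u) / r" using uv r by simp
    ultimately show False by simp
  qed
  then show ?thesis using const[OF s] by simp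
qed

lemma line_segment_angle:
  assumes X: "(L, X) \<in> joining_curves P A B" and norm: "norm a = 1"
    and cont: "continuous_on {0..L} \<phi>"
    and \<phi>: "\<And>s. s \<in> {0..L} \<Longrightarrow> tangent L X s = a * cis (\<phi> s)"
    and uv: "0 \<le> u" "u < v" "v \<le> L" and line: "line_segment X u v"
    and st: "s \<in> {u..v}" "t \<in> {u..v}"
  shows "\<phi> s = \<phi> t"
proof -
  obtain p w where line: "\<And>s. s \<in> {u..v} \<Longrightarrow> X s = p + (s - u) *\<^sub>R w"
    using line by (auto simp: line_segment_def)
  have tangent: "a * cis (\<phi> s) = w" if s: "s \<in> {u..v}" for s
  proof (rule vector_derivative_unique_within)
    show "at s within {u..v} \<noteq> bot"
      using uv(2) s by (simp add: trivial_limit_within islimpt_Icc)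
    have "(X has_vector_derivative tangent L X s) (at s within {0..L})"
      using joining_has_tangent[OF X] s uv by auto
    then show "(X has_vector_derivative a * cis (\<phi> s)) (at s within {u..v})"
      using \<phi>[of s] s uv by (auto intro: has_vector_derivative_within_subset)
    have "((\<lambda>s. p + (s - u) *\<^sub>R w) has_vector_derivative w) (at s within {u..v})"
      by (auto intro!: derivative_eq_intros)
    then show "(X has_vector_derivative w) (at s within {u..v})"
      by (rule has_vector_derivative_transform[rotated 2]) (use s line in auto)
  qed
  have "a \<noteq> 0" using norm by auto
  then have "cis (\<phi> s) = inverse a * w" if "s \<in> {u..v}" for s
    using tangent[OF that] by auto
  then show ?thesis
    using st uv by (intro angle_constant[of u v \<phi> "inverse a * w"] continuous_on_subset[OF cont]) auto
qed

text \<open>All three shapes of \<open>\<J>\<close> are arc-line-arc curves with one arc degenerate; a single arc is the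
  case \<open>g = 0\<close>.\<close>

lemma J_curve_angle:
  assumes PA: "P \<noteq> A" and PB: "P \<noteq> B" and \<Omega>: "0 < Omega P A B" "Omega P A B < pi"
    and J: "is_J_curve P A B r (L, X)"
    and X: "(L, X) \<in> joining_curves P A B" and \<phi>: "continuous_on {0..L} \<phi>" "\<phi> 0 = 0"
    "\<phi> L = Omega P A B" "mono_on {0..L} \<phi>"
    "\<And>s. s \<in> {0..L} \<Longrightarrow> tangent L X s = alpha P A * cis (\<phi> s)"
  obtains g \<psi> where "0 \<le> g" "\<psi> \<in> {0, Omega P A B}" "L = r * Omega P A B + g"
    "\<And>s. s \<in> {0..L} \<Longrightarrow> \<phi> s = arc_line_arc r (r * \<psi>) (r * \<psi> + g) s"
proof -
  let ?\<Omega> = "Omega P A B"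
  have r: "0 < r" using J by simp
  have L: "0 < L" using X by (simp add: joining_curves_def)
  note arc_angle = circular_arc_angle[OF X norm_alpha[OF PA PB] r \<phi>(1,4,5)]
  note line_angle = line_segment_angle[OF X norm_alpha[OF PA PB] \<phi>(1,5)]
  consider (arc) "circular_arc r X 0 L"
    | (arc_line) m where "0 < m" "m < L" "circular_arc r X 0 m" "line_segment X m L"
    | (line_arc) m where "0 < m" "m < L" "line_segment X 0 m" "circular_arc r X m L"
    using J by (auto split: if_splits)
  then show ?thesis
  proof cases
    case arc
    then have *: "\<phi> s = s / r" if "s \<in> {0..L}" for s using arc_angle[of 0 L s] that L \<phi>(2) by simp
    then have "L = r * ?\<Omega>" using *[of L] \<phi>(3) L r by (simp add: field_simps)
    then show ?thesis
      using that[of 0 ?\<Omega>] * r by (auto simp: arc_line_arc_def)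
  next
    case arc_line
    have *: "\<phi> s = s / r" if "s \<in> {0..m}" for s using arc_angle[of 0 m s] that arc_line \<phi>(2) by simp
    have **: "\<phi> s = ?\<Omega>" if "s \<in> {m..L}" for s using line_angle[of m L s L] that arc_line \<phi>(3) by simp
    have m: "m = r * ?\<Omega>" using *[of m] **[of m] arc_line r by (simp add: field_simps)
    show ?thesis
    proof (rule that[of "L - m" ?\<Omega>])
      show "\<phi> s = arc_line_arc r (r * ?\<Omega>) (r * ?\<Omega> + (L - m)) s" if s: "s \<in> {0..L}" for s
        using *[of s] **[of s] s m r by (cases "s \<le> m") (auto simp: arc_line_arc_def)
    qed (use arc_line m in auto)
  next
    case line_arc
    have *: "\<phi> s = 0" if "s \<in> {0..m}" for s using line_angle[of 0 m s 0] that line_arc \<phi>(2) by simp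
    have **: "\<phi> s = (s - m) / r" if "s \<in> {m..L}" for s
      using arc_angle[of m L s] that line_arc *[of m] by simp
    have m: "L - m = r * ?\<Omega>" using **[of L] \<phi>(3) line_arc r by (simp add: field_simps)
    show ?thesis
    proof (rule that[of m 0])
      show "\<phi> s = arc_line_arc r (r * 0) (r * 0 + m) s" if s: "s \<in> {0..L}" for s
        using *[of s] **[of s] s m r by (cases "s \<le> m") (auto simp: arc_line_arc_def)
    qed (use line_arc m in auto)
  qed
qed

text \<open>If the segment continues one of the two tangents, the closing equation determines \<open>R\<close>.\<close>

lemma closing_radius:
  fixes x y R g \<Omega> \<psi> :: real
  assumes \<Omega>: "0 < \<Omega>" "\<Omega> < pi" and R: "0 < R" and g: "0 \<le> g" and \<psi>: "\<psi> \<in> {0, \<Omega>}"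
    and closing: "x + y * cis \<Omega> = - (\<i> * R) * (cis \<Omega> - 1) + g *\<^sub>R cis \<psi>"
  shows "R * tan (\<Omega> / 2) = min x y"
proof -
  let ?t = "R * tan (\<Omega> / 2)"
  have s: "sin \<Omega> \<noteq> 0" using sin_gt_zero[OF \<Omega>] by simp
  note e = arc_displacement[OF \<Omega>, of R]
  have unique: "p = p' \<and> q = q'" if "p + q * cis \<Omega> = p' + q' * cis \<Omega>" for p q p' q' :: real
  proof -
    have "q * sin \<Omega> = q' * sin \<Omega>" using arg_cong[OF that, of Im] by simp
    then have "q = q'" using s by simp
    then show ?thesis using that by simp
  qed
  show ?thesis
  proof (cases "\<psi> = 0")
    case True
    then have "x + y * cis \<Omega> = (?t + g) + ?t * cis \<Omega>"
      using closing unfolding e by (simp add: scaleR_conv_of_real algebra_simps)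
    then have "x = ?t + g \<and> y = ?t" by (intro unique) simp
    then show ?thesis using g by simp
  next
    case False
    then have "x + y * cis \<Omega> = ?t + (?t + g) * cis \<Omega>"
      using closing \<psi> unfolding e by (simp add: scaleR_conv_of_real algebra_simps)
    then have "x = ?t \<and> y = ?t + g" by (intro unique) simp
    then show ?thesis using g by simp
  qed
qed

lemma J_curve_is_geodesic:
  assumes PA: "P \<noteq> A" and PB: "P \<noteq> B" and \<Omega>: "0 < Omega P A B" "Omega P A B < pi"
    and J: "is_J_curve P A B r G"
  shows "r * tan (Omega P A B / 2) = min (dist P A) (dist P B)"
    and "is_dubins_geodesic P A B r G"
proof -
  let ?\<Omega> = "Omega P A B"
  obtain L X where G: "G = (L, X)" by (cases G)
  have r: "0 < r" and E: "(L, X) \<in> curves_E P A B" using J G by auto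
  have X: "(L, X) \<in> joining_curves P A B" using E by (simp add: curves_E_def)
  have L: "0 < L" and XL: "X L = B" using X by (auto simp: joining_curves_def)
  note na = norm_alpha[OF PA PB]
  obtain \<phi> where \<phi>: "continuous_on {0..L} \<phi>" "\<phi> 0 = 0" "\<phi> L = ?\<Omega>" "mono_on {0..L} \<phi>"
    "\<And>s. s \<in> {0..L} \<Longrightarrow> tangent L X s = alpha P A * cis (\<phi> s)"
    using curves_E_angle[OF E] by metis
  obtain g \<psi> where g: "0 \<le> g" and \<psi>: "\<psi> \<in> {0, ?\<Omega>}" and len: "L = r * ?\<Omega> + g"
    and eq: "\<And>s. s \<in> {0..L} \<Longrightarrow> \<phi> s = arc_line_arc r (r * \<psi>) (r * \<psi> + g) s"
    using J_curve_angle[OF PA PB \<Omega> J[unfolded G] X \<phi>] by metis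
  have "(X L - A) / alpha P A = dist P A + dist P B * cis ?\<Omega>"
    unfolding XL chord_eq[OF PA PB] using na by auto
  then have "((\<lambda>t. cis (arc_line_arc r (r * \<psi>) (r * \<psi> + g) t)) has_integral
      (dist P A + dist P B * cis ?\<Omega>)) {0..L}"
    using joining_displacement[OF X na, of "arc_line_arc r (r * \<psi>) (r * \<psi> + g)" L] \<phi>(5) eq L by simp
  moreover have "((\<lambda>t. cis (arc_line_arc r (r * \<psi>) (r * \<psi> + g) t)) has_integral
      (- (\<i> * r) * (cis ?\<Omega> - 1) + (L - r * ?\<Omega>) *\<^sub>R cis (r * \<psi> / r))) {0..L}"
    using integral_arc_line_arc[OF r, of "r * \<psi>" "r * \<psi> + g" L] \<psi> \<Omega> r g L eq[of L] \<phi>(3) by auto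
  ultimately have "dist P A + dist P B * cis ?\<Omega> =
      - (\<i> * r) * (cis ?\<Omega> - 1) + (L - r * ?\<Omega>) *\<^sub>R cis (r * \<psi> / r)"
    by (rule has_integral_unique)
  moreover have "L - r * ?\<Omega> = g" "r * \<psi> / r = \<psi>" using len r by auto
  ultimately have closing: "dist P A + dist P B * cis ?\<Omega> = - (\<i> * r) * (cis ?\<Omega> - 1) + g *\<^sub>R cis \<psi>"
    by (simp only:)
  then show "r * tan (?\<Omega> / 2) = min (dist P A) (dist P B)"
    by (rule closing_radius[OF \<Omega> r g \<psi>])
  have "0 \<le> \<psi>" "\<psi> \<le> ?\<Omega>" using \<psi> \<Omega> by auto
  note geodesic_iff = geodesic_iff_arc_line_arc_curve(1)[OF PA PB \<Omega> r this g closing]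
  show "is_dubins_geodesic P A B r G"
    unfolding geodesic_iff unfolding G len[symmetric]
    by (rule joining_eq_arc_line_arc_curve[OF X na \<phi>(5) eq])
qed

text \<open>A candidate is written down: the radius is dictated by the shorter of the two distances, the
  segment has length \<open>\<bar>dist P B - dist P A\<bar>\<close> and continues the tangent on the side of the more
  distant end point.\<close>

lemma J_curve_exists:
  assumes PA: "P \<noteq> A" and PB: "P \<noteq> B" and \<Omega>: "0 < Omega P A B" "Omega P A B < pi"
  obtains r G where "is_J_curve P A B r G"
proof -
  let ?\<Omega> = "Omega P A B" and ?dA = "dist P A" and ?dB = "dist P B"
  define a where "a = alpha P A"
  define r where "r = min ?dA ?dB / tan (?\<Omega> / 2)"
  define g where "g = \<bar>?dB - ?dA\<bar>"
  define \<psi> where "\<psi> = (if ?dA \<le> ?dB then ?\<Omega> else 0)"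
  define L where "L = r * ?\<Omega> + g"
  define m1 where "m1 = r * \<psi>"
  define m2 where "m2 = m1 + g"
  note half = minus_i_cis_minus_one[OF \<Omega>]
  have na: "norm a = 1" using norm_alpha[OF PA PB] by (simp add: a_def)
  have r: "0 < r" using PA PB half(3) by (simp add: r_def)
  have g: "0 \<le> g" by (simp add: g_def)
  have \<psi>: "0 \<le> \<psi>" "\<psi> \<le> ?\<Omega>" using \<Omega> by (auto simp: \<psi>_def)
  have r\<Omega>: "0 < r * ?\<Omega>" "r * ?\<Omega> < r * pi" using r \<Omega> by auto
  have L: "0 < L" using r\<Omega> g by (simp add: L_def)
  have closing: "?dA + ?dB * cis ?\<Omega> = - (\<i> * r) * (cis ?\<Omega> - 1) + g *\<^sub>R cis \<psi>"
  proof -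
    have "r * tan (?\<Omega> / 2) = min ?dA ?dB" using half(3) by (simp add: r_def)
    then have h: "- (\<i> * r) * (cis ?\<Omega> - 1) =
        complex_of_real (min ?dA ?dB) + complex_of_real (min ?dA ?dB) * cis ?\<Omega>"
      using arc_displacement[OF \<Omega>, of r] by (simp only:)
    show ?thesis unfolding h
      by (auto simp: g_def \<psi>_def min_def scaleR_conv_of_real algebra_simps)
  qed
  let ?G = "arc_line_arc_curve A a r m1 m2 L"
  define X where "X = snd ?G"
  have G: "?G = (L, X)" by (simp add: X_def arc_line_arc_curve_def)
  have E: "?G \<in> curves_E P A B"
    using geodesic_iff_arc_line_arc_curve(2)[OF PA PB \<Omega> r \<psi> g closing]
    by (simp add: a_def m1_def m2_def L_def)
  have m: "0 \<le> m1" "m1 \<le> m2" using r \<psi> g by (auto simp: m1_def m2_def)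
  have X: "X s = A + a * (- (\<i> * r) * (cis (arc_line_arc r m1 m2 s) - 1) +
      (s - r * arc_line_arc r m1 m2 s) *\<^sub>R cis (m1 / r))" if "s \<in> {0..L}" for s
    using that integral_unique[OF integral_arc_line_arc[OF r m, of s]]
    by (simp add: X_def arc_line_arc_curve_def)
  define \<theta> where "\<theta> = Arg (- \<i> * a)"
  have "norm (- \<i> * a) = 1" by (simp add: norm_mult na)
  then have \<theta>: "- \<i> * a = cis \<theta>"
    unfolding \<theta>_def by (subst cis_Arg) (auto simp: sgn_div_norm)
  have arcI: "circular_arc r X u v" if uv: "0 \<le> u" "v \<le> L"
    and p: "\<And>s. s \<in> {u..v} \<Longrightarrow> arc_line_arc r m1 m2 s = (s - u) / r" for u v
    unfolding circular_arc_def
  proof (intro exI conjI ballI)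
    fix s assume s: "s \<in> {u..v}"
    have "X s = A + a * (- (\<i> * r) * (cis ((s - u) / r) - 1) + u *\<^sub>R cis (m1 / r))"
      using X[of s] s uv p[OF s] r by simp
    also have "\<dots> = (A + a * (\<i> * r + u *\<^sub>R cis (m1 / r))) + r *\<^sub>R ((- \<i> * a) * cis ((s - u) / r))"
      by (simp add: scaleR_conv_of_real algebra_simps)
    finally show "X s = (A + a * (\<i> * r + u *\<^sub>R cis (m1 / r))) + r *\<^sub>R cis (\<theta> + 1 * (s - u) / r)"
      unfolding \<theta> by (simp add: cis_mult)
  qed auto
  have lineI: "line_segment X u v" if uv: "0 \<le> u" "v \<le> L"
    and p: "\<And>s. s \<in> {u..v} \<Longrightarrow> arc_line_arc r m1 m2 s = m1 / r" for u v
    unfolding line_segment_def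
  proof (intro exI conjI ballI)
    show "norm (a * cis (m1 / r)) = 1" using na by (simp add: norm_mult)
    fix s assume s: "s \<in> {u..v}"
    then show "X s = A + a * (- (\<i> * r) * (cis (m1 / r) - 1) + (u - m1) *\<^sub>R cis (m1 / r)) +
        (s - u) *\<^sub>R (a * cis (m1 / r))"
      using X[of s] uv p[OF s] r by (simp add: scaleR_conv_of_real algebra_simps)
  qed
  have "is_J_curve P A B r ?G"
  proof (cases "?dA = ?dB")
    case True
    then have "m1 = L" "m2 = L" by (auto simp: m1_def m2_def L_def \<psi>_def g_def)
    moreover from this have "circular_arc r X 0 L"
      by (intro arcI) (auto simp: arc_line_arc_def)
    moreover have "L < r * pi" using True r\<Omega> by (simp add: L_def g_def)
    ultimately show ?thesis using True E r unfolding G by simp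
  next
    case False
    then have g: "0 < g" by (simp add: g_def)
    show ?thesis
    proof (cases "?dA < ?dB")
      case True
      then have *: "m1 = r * ?\<Omega>" "m2 = L" "m1 < L" using g by (auto simp: m1_def m2_def L_def \<psi>_def)
      have "circular_arc r X 0 m1" using * by (intro arcI) (auto simp: arc_line_arc_def)
      moreover have "line_segment X m1 L" using * m by (intro lineI) (auto simp: arc_line_arc_def)
      ultimately show ?thesis using False E r * r\<Omega> unfolding G by auto
    next
      case dBA: False
      then have *: "m1 = 0" "m2 = g" "L = r * ?\<Omega> + m2" using False by (auto simp: m1_def m2_def L_def \<psi>_def)
      have "line_segment X 0 m2" using * r\<Omega> g by (intro lineI) (auto simp: arc_line_arc_def)
      moreover have "circular_arc r X m2 L" using * g by (intro arcI) (auto simp: arc_line_arc_def)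
      ultimately show ?thesis using False E r * r\<Omega> g unfolding G by (auto intro!: exI[of _ m2])
    qed
  qed
  then show ?thesis by (rule that)
qed

lemma geodesic_below_radius:
  assumes PA: "P \<noteq> A" and PB: "P \<noteq> B" and \<Omega>: "0 < Omega P A B" "Omega P A B < pi"
    and R: "0 < R" and le: "R * tan (Omega P A B / 2) \<le> min (dist P A) (dist P B)"
  obtains G0 where "G0 \<in> curves_E P A B" "\<And>G. is_dubins_geodesic P A B R G \<longleftrightarrow> G = G0"
proof -
  let ?\<Omega> = "Omega P A B" and ?dA = "dist P A" and ?dB = "dist P B"
  let ?t = "R * tan (?\<Omega> / 2)"
  obtain g \<psi> where g: "0 \<le> g" "0 \<le> \<psi>" "\<psi> \<le> ?\<Omega>"
    and e: "complex_of_real (?dA - ?t) + complex_of_real (?dB - ?t) * cis ?\<Omega> = g *\<^sub>R cis \<psi>"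
    using cone_polar_form[OF _ _ \<Omega>, of "?dA - ?t" "?dB - ?t"] le by auto
  have "?dA + ?dB * cis ?\<Omega> = - (\<i> * R) * (cis ?\<Omega> - 1) + g *\<^sub>R cis \<psi>"
    unfolding e[symmetric] arc_displacement[OF \<Omega>, of R] by (simp add: algebra_simps)
  from geodesic_iff_arc_line_arc_curve[OF PA PB \<Omega> R g(2,3,1) this]
  show ?thesis using that by blast
qed

section \<open>Dubins geodesics in \<open>\<E>\<close>\<close>

theorem mainTheorem3:
  fixes P A B :: complex
  assumes "P \<noteq> A" and "P \<noteq> B" and "A \<noteq> B"
    and "0 < Omega P A B" and "Omega P A B < pi"
  shows "set_F P A B = {0<..R_a P A B}
    \<and> (\<forall>R \<in> set_F P A B. \<exists>!G. is_dubins_geodesic P A B R G)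
    \<and> (\<forall>G. is_dubins_geodesic P A B (R_a P A B) G \<longleftrightarrow> G = J_curve P A B)"
proof -
  note PA = assms(1) and PB = assms(2) and \<Omega> = assms(4,5)
  let ?t = "tan (Omega P A B / 2)" and ?d = "min (dist P A) (dist P B)"
  have t: "0 < ?t" by (rule minus_i_cis_minus_one(3)[OF \<Omega>])
  obtain r J where J: "is_J_curve P A B r J" using J_curve_exists[OF PA PB \<Omega>] .
  then have r: "0 < r" by (cases J) simp
  have rt: "r * ?t = ?d" by (rule J_curve_is_geodesic(1)[OF PA PB \<Omega> J])
  have radius: "r' = r" if "is_J_curve P A B r' G" for r' G
    using J_curve_is_geodesic(1)[OF PA PB \<Omega> that] rt t by (metis mult_right_cancel less_irrefl)
  obtain G0 where G0: "\<And>G. is_dubins_geodesic P A B r G \<longleftrightarrow> G = G0"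
    using geodesic_below_radius[OF PA PB \<Omega> r] rt by (metis order_refl)
  have unique: "G = J" if "is_J_curve P A B r' G" for r' G
    using J_curve_is_geodesic(2)[OF PA PB \<Omega>] that J radius G0 by metis
  have J_eq: "J_curve P A B = J"
    unfolding J_curve_def using J unique by (intro the_equality) blast+
  have R_eq: "R_a P A B = r"
    unfolding R_a_def J_eq using J radius by (intro the_equality) blast+
  have small: "R * ?t \<le> ?d \<longleftrightarrow> R \<le> r" for R
    unfolding rt[symmetric] using t by simp
  have "set_F P A B = {0<..r}"
  proof (intro equalityI subsetI)
    fix R assume "R \<in> set_F P A B"
    then obtain G where "0 < R" "is_dubins_geodesic P A B R G" "G \<in> curves_E P A B"
      by (auto simp: set_F_def)
    then show "R \<in> {0<..r}"
      using curves_E_radius_bound[OF PA PB \<Omega>, of R G] small by (auto simp: is_dubins_geodesic_def)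
  next
    fix R assume "R \<in> {0<..r}"
    then have R: "0 < R" "R * ?t \<le> ?d" using small by auto
    obtain G where "G \<in> curves_E P A B" "\<And>G'. is_dubins_geodesic P A B R G' \<longleftrightarrow> G' = G"
      using geodesic_below_radius[OF PA PB \<Omega> R] by blast
    then show "R \<in> set_F P A B" using R unfolding set_F_def by blast
  qed
  moreover have "\<exists>!G. is_dubins_geodesic P A B R G" if "R \<in> {0<..r}" for R
  proof -
    have R: "0 < R" "R * ?t \<le> ?d" using small that by auto
    obtain G where "\<And>G'. is_dubins_geodesic P A B R G' \<longleftrightarrow> G' = G"
      using geodesic_below_radius[OF PA PB \<Omega> R] by blast
    then show ?thesis by auto
  qed
  moreover have "is_dubins_geodesic P A B r G \<longleftrightarrow> G = J" for G
    using J_curve_is_geodesic(2)[OF PA PB \<Omega> J] G0 by auto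
  ultimately show ?thesis unfolding R_eq J_eq by auto
qed

end
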